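(* The set $\mathcal{M}_{\mathrm{H}(C)_*}$ of increasing monomials in the generators $C$ and $\hat y_j^{(r)}$ ($j=1,\dots,N-1$, $r\in\mathbb Z\setminus\{0\}$) forms a topological basis of $\mathrm{H}(C)_*$ over $\mathbb C[[h]]$ (i.e., it is linearly independent over $\mathbb C[[h]]$ and its $\mathbb C[[h]]$-span is $h$-adically dense in $\mathrm{H}(C)_*$).
   Context: $N\geqslant 2$ is an integer and $h$ a formal parameter. Expressions $(x_1+\dots+x_n)^r$ with $r<0$ are expanded in nonnegative powers of $x_2,\dots,x_n$. **The series $S$.** Let $R(u)=I-\frac hu P$ on $\mathbb C^N\otimes\mathbb C^N$, $I$ the identity, $P=\sum_{i,j}e_{ij}\otimes e_{ji}$ ($e_{ij}$ matrix units). There is a unique series $G(u,C)=1+\frac{C+N}{N}\frac{h^2}{u^2}-\dots\in\mathbb C[C][[h/u]]$ with $\mathrm{tr}_1(G(u,C)R(u)R(-u-hC)-I)=\mathrm{tr}_2(G(u,C)R(u)R(-u-hC)-I)=0$ ($\mathrm{tr}_i$ is the trace over the $i$-th tensor factor). Put $S(u,C)=h^{-2}(G(u,C)R(u)R(-u-hC)-I)$ and let $s_{ij}(u,C)\in\mathbb C[C,u^{-1}][[h]]$ be the coefficient of $e_{ii}\otimes e_{jj}$ in $S(u,C)$. **The algebra $\mathrm{H}(C)_*$** is the $h$-adically complete associative algebra over $\mathbb C[[h]]$ generated by a central element $C$ and elements $y_i^{(r)}$, $i=1,\dots,N$, $r\in\mathbb Z\setminus\{0\}$, subject to the relations, written with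 $y^i(u)=\sum_{r\in\mathbb Z\setminus\{0\}}y_i^{(r)}u^{-r-1}$, $$y^i(u)y^j(v)+s_{ij}(u-v,C)=y^j(v)y^i(u)+s_{ij}(v-u,C)\quad(i,j=1,\dots,N),\qquad y^1(u)+\dots+y^N(u)=0.$$ **The generators $\hat y_j^{(r)}$.** Let $\mathfrak h$ be the complex vector space (abelian Lie algebra) spanned by $a_1,\dots,a_N$ with the single relation $a_1+\dots+a_N=0$, with the symmetric bilinear form $\langle a_i,a_j\rangle=\delta_{ij}-\frac1N$. Let $\hat a_1,\dots,\hat a_{N-1}$ be an orthonormal basis of $\mathfrak h$ of the form $\hat a_j=\sum_{i=1}^j\nu_{ij}a_i$, $\nu_{ij}\in\mathbb C$. Put $\hat y_j^{(r)}=\sum_{i=1}^j\nu_{ij}y_i^{(r)}$ for $j=1,\dots,N-1$, $r\in\mathbb Z\setminus\{0\}$. Order these generators linearly by $C\prec\hat y_j^{(r)}$ for all $j,r$, and $\hat y_i^{(s)}\prec\hat y_j^{(r)}$ if $s<r$, or $s=r$ and $i<j$. $\mathcal M_{\mathrm{H}(C)_*}$ is the family of all increasing monomials $m_n\cdots m_1$, $n\geqslant0$, where each $m_k$ is one of $C$, $\hat y_j^{(r)}$ ($j=1,\dots,N-1$, $r\neq0$) and $m_n\preceq\dots\preceq m_1$ (the empty monomial being $1$). *)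

theory Defs
  imports
    "HOL-Library.Poly_Mapping"
    "HOL-Computational_Algebra.Polynomial"
    "HOL-Computational_Algebra.Formal_Power_Series"
    "HOL-Algebra.QuotRing"
    "HOL-Algebra.Module"
begin

unbundle fps_syntax

section \<open>The series S\<close>

text \<open>
  The coefficient ring is C[C][u^{-1}][[h]]. In \<^typ>\<open>complex poly poly fps\<close> the power series
  variable is h, the variable of the outer polynomials is u^{-1} and that of the inner ones is C.
\<close>

type_synonym coeff_ring = "complex poly poly fps"

abbreviation u_inv :: coeff_ring where
  "u_inv \<equiv> fps_const (monom 1 1)"

text \<open>
  (-u-hC)^{-1} in nonnegative powers of hC: the sum over k of (-1)^{k+1} C^k h^k u^{-k-1}.
\<close>

definition minus_u_hC_inv :: coeff_ring where
  "minus_u_hC_inv = Abs_fps (\<lambda>k. monom (monom ((-1) ^ (k + 1)) k) (k + 1))"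

lemma minus_u_hC_inv_eq:
  "(1 + fps_X * fps_const (monom (monom 1 1) 1)) * minus_u_hC_inv = - u_inv"
proof (rule fps_ext)
  fix n
  show "((1 + fps_X * fps_const (monom (monom 1 1) 1)) * minus_u_hC_inv) $ n = (- u_inv) $ n"
    by (cases n) (simp_all add: minus_u_hC_inv_def distrib_right mult.assoc mult_monom minus_monom
      add_monom monom_0 one_pCons)
qed

text \<open>
  An operator on the tensor square of C^N with coefficients in a ring: \<open>X i j k l\<close> is the
  coefficient of e_{ij} \<open>\<otimes>\<close> e_{kl}. Only indices in \<open>{1..N}\<close> are relevant.
\<close>

type_synonym 'a tensor_op = "nat \<Rightarrow> nat \<Rightarrow> nat \<Rightarrow> nat \<Rightarrow> 'a"

definition id_op :: "'a::ring_1 tensor_op" where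
  "id_op i j k l = (if i = j \<and> k = l then 1 else 0)"

definition perm_op :: "'a::ring_1 tensor_op" where
  "perm_op i j k l = (if k = j \<and> l = i then 1 else 0)"

definition mult_op :: "nat \<Rightarrow> 'a::ring_1 tensor_op \<Rightarrow> 'a tensor_op \<Rightarrow> 'a tensor_op" where
  "mult_op N X Y i j k l = (\<Sum>a=1..N. \<Sum>b=1..N. X i a k b * Y a j b l)"

definition trace1 :: "nat \<Rightarrow> 'a::ring_1 tensor_op \<Rightarrow> nat \<Rightarrow> nat \<Rightarrow> 'a" where
  "trace1 N X k l = (\<Sum>i=1..N. X i i k l)"

definition trace2 :: "nat \<Rightarrow> 'a::ring_1 tensor_op \<Rightarrow> nat \<Rightarrow> nat \<Rightarrow> 'a" where
  "trace2 N X i j = (\<Sum>k=1..N. X i j k k)"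

text \<open>The Yang R-matrix R(w) as a function of w^{-1}.\<close>

definition R_op :: "coeff_ring \<Rightarrow> coeff_ring tensor_op" where
  "R_op w_inv i j k l = id_op i j k l - fps_X * w_inv * perm_op i j k l"

definition GRR_minus_id :: "nat \<Rightarrow> coeff_ring \<Rightarrow> coeff_ring tensor_op" where
  "GRR_minus_id N G i j k l =
    G * mult_op N (R_op u_inv) (R_op minus_u_hC_inv) i j k l - id_op i j k l"

text \<open>
  The first conjunct says that G lies in C[C][[h/u]]. For \<open>N \<ge> 1\<close> there is exactly one such G, so
  that the definite description in \<open>G_series\<close> is meaningful.
\<close>

definition is_G_series :: "nat \<Rightarrow> coeff_ring \<Rightarrow> bool" where
  "is_G_series N G \<longleftrightarrow>
    (\<exists>g :: complex poly fps. G = Abs_fps (\<lambda>n. monom (g $ n) n)) \<and>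
    (\<forall>k\<in>{1..N}. \<forall>l\<in>{1..N}. trace1 N (GRR_minus_id N G) k l = 0) \<and>
    (\<forall>i\<in>{1..N}. \<forall>j\<in>{1..N}. trace2 N (GRR_minus_id N G) i j = 0)"

definition G_series :: "nat \<Rightarrow> coeff_ring" where
  "G_series N = (THE G. is_G_series N G)"

text \<open>
  The coefficients of h^0 and h^1 in G(u,C) R(u) R(-u-hC) - I vanish, so that \<^const>\<open>fps_shift\<close>
  is the multiplication by h^{-2}.
\<close>

definition s_series :: "nat \<Rightarrow> nat \<Rightarrow> nat \<Rightarrow> coeff_ring" where
  "s_series N i j = fps_shift 2 (GRR_minus_id N (G_series N) i i j j)"

text \<open>
  The coefficient of x^a y^b in the expansion of (x-y)^{-m} in nonnegative powers of y.
\<close>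

definition expand_coeff :: "nat \<Rightarrow> int \<Rightarrow> int \<Rightarrow> complex" where
  "expand_coeff m a b =
    (if 0 \<le> b \<and> a = - int m - b then (- 1) ^ nat b * ((- of_nat m) gchoose nat b) else 0)"

text \<open>
  The coefficient, in C[C][[h]], of x^a y^b in s(x-y,C), expanded in nonnegative powers of y.
\<close>

definition subst_coeff :: "coeff_ring \<Rightarrow> int \<Rightarrow> int \<Rightarrow> complex poly fps" where
  "subst_coeff s a b =
    Abs_fps (\<lambda>k. \<Sum>m\<le>degree (s $ k). [:expand_coeff m a b:] * coeff (s $ k) m)"


section \<open>Completed free algebras\<close>

text \<open>The free monoid.\<close>

datatype 'g fword = FWord (letters: "'g list")

instantiation fword :: (type) monoid_add
begin

definition zero_fword :: "'a fword" where
  "0 = FWord []"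

definition plus_fword :: "'a fword \<Rightarrow> 'a fword \<Rightarrow> 'a fword" where
  "v + w = FWord (letters v @ letters w)"

instance
  by standard (simp_all add: zero_fword_def plus_fword_def)

end

text \<open>
  The monoid algebra of the free monoid is the free algebra over the complex numbers. The h-adic
  completion of the free C[[h]]-algebra consists of the formal power series in h with coefficients
  in it.
\<close>

type_synonym 'g free_series = "('g fword \<Rightarrow>\<^sub>0 complex) fps"

definition gen_series :: "'g \<Rightarrow> 'g free_series" where
  "gen_series g = fps_const (Poly_Mapping.single (FWord [g]) 1)"

definition scalar_series :: "complex fps \<Rightarrow> 'g free_series" where
  "scalar_series c = Abs_fps (\<lambda>k. Poly_Mapping.single 0 (c $ k))"

text \<open>The completed free algebra over C[[h]] on a set of generators.\<close>

definition completed_free_algebra :: "'g set \<Rightarrow> 'g free_series ring" where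
  "completed_free_algebra X =
    \<lparr>carrier = {f. \<forall>k. \<forall>w\<in>Poly_Mapping.keys (f $ k). set (letters w) \<subseteq> X},
     mult = (*), one = 1, zero = 0, add = (+)\<rparr>"

text \<open>The h-adic closure of the two-sided ideal generated by a set of relators.\<close>

definition closed_ideal :: "'g set \<Rightarrow> 'g free_series set \<Rightarrow> 'g free_series set" where
  "closed_ideal X rels =
    {f \<in> carrier (completed_free_algebra X).
      \<forall>n. \<exists>a \<in> Idl\<^bsub>completed_free_algebra X\<^esub> rels. \<exists>b \<in> carrier (completed_free_algebra X).
        f = a + fps_X ^ n * b}"

text \<open>
  The h-adically complete algebra over C[[h]] with the given generators and relators: the quotient
  of the completed free algebra by the closed ideal.
\<close>

definition presented_algebra ::
  "'g set \<Rightarrow> 'g free_series set \<Rightarrow> (complex fps, 'g free_series set) module" where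
  "presented_algebra X rels =
    (let F = completed_free_algebra X; J = closed_ideal X rels; Q = F Quot J in
      \<lparr>carrier = carrier Q, mult = mult Q, one = one Q, zero = zero Q, add = add Q,
       smult = (\<lambda>c x. (J +>\<^bsub>F\<^esub> scalar_series c) \<otimes>\<^bsub>Q\<^esub> x)\<rparr>)"

definition presented_gen :: "'g set \<Rightarrow> 'g free_series set \<Rightarrow> 'g \<Rightarrow> 'g free_series set" where
  "presented_gen X rels g = closed_ideal X rels +>\<^bsub>completed_free_algebra X\<^esub> gen_series g"


section \<open>The algebra H(C)_*\<close>

text \<open>\<open>GY i r\<close> stands for y_i^{(r)}, and also for its modification in the increasing monomials.\<close>

datatype gen = GC | GY nat int

definition H_gens :: "nat \<Rightarrow> gen set" where
  "H_gens N = {GC} \<union> {GY i r | i r. i \<in> {1..N} \<and> r \<noteq> 0}"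

text \<open>The coefficient of u^{-r-1} in y^i(u); the series has no term with r = 0.\<close>

definition y_coeff :: "nat \<Rightarrow> int \<Rightarrow> gen free_series" where
  "y_coeff i r = (if r = 0 then 0 else gen_series (GY i r))"

definition central_series :: "complex poly fps \<Rightarrow> gen free_series" where
  "central_series p = Abs_fps (\<lambda>k. \<Sum>n\<le>degree (p $ k).
     Poly_Mapping.single (FWord (replicate n GC)) (coeff (p $ k) n))"

text \<open>
  \<open>yy_relator N i j r s\<close> is the coefficient of u^{-r-1} v^{-s-1} in the difference of the two sides
  of the quadratic relation. In s_{ij}(v-u,C) the roles of u and v are exchanged.
\<close>

definition yy_relator :: "nat \<Rightarrow> nat \<Rightarrow> nat \<Rightarrow> int \<Rightarrow> int \<Rightarrow> gen free_series" where
  "yy_relator N i j r s =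
    (y_coeff i r * y_coeff j s
      + central_series (subst_coeff (s_series N i j) (- r - 1) (- s - 1)))
    - (y_coeff j s * y_coeff i r
      + central_series (subst_coeff (s_series N i j) (- s - 1) (- r - 1)))"

definition H_rels :: "nat \<Rightarrow> gen free_series set" where
  "H_rels N =
    {gen_series GC * gen_series g - gen_series g * gen_series GC | g. g \<in> H_gens N}
    \<union> {yy_relator N i j r s | i j r s. i \<in> {1..N} \<and> j \<in> {1..N}}
    \<union> {(\<Sum>i=1..N. y_coeff i r) | r. True}"

definition H_algebra :: "nat \<Rightarrow> (complex fps, gen free_series set) module" where
  "H_algebra N = presented_algebra (H_gens N) (H_rels N)"

definition H_gen :: "nat \<Rightarrow> gen \<Rightarrow> gen free_series set" where
  "H_gen N g = presented_gen (H_gens N) (H_rels N) g"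


section \<open>Increasing monomials\<close>

text \<open>
  A function \<open>x\<close> represents the element of the space spanned by a_1,...,a_N that is the sum of the
  \<open>x i\<close> a_i over \<open>i \<in> {1..N}\<close>. As a_1 + ... + a_N = 0 is the only relation, this element is
  zero iff \<open>x\<close> is constant on \<open>{1..N}\<close>.
\<close>

definition is_zero_comb :: "nat \<Rightarrow> (nat \<Rightarrow> complex) \<Rightarrow> bool" where
  "is_zero_comb N x \<longleftrightarrow> (\<exists>c. \<forall>i\<in>{1..N}. x i = c)"

definition comb_form :: "nat \<Rightarrow> (nat \<Rightarrow> complex) \<Rightarrow> (nat \<Rightarrow> complex) \<Rightarrow> complex" where
  "comb_form N x y =
    (\<Sum>i=1..N. \<Sum>j=1..N. x i * y j * ((if i = j then 1 else 0) - 1 / of_nat N))"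

definition hat_comb :: "(nat \<Rightarrow> nat \<Rightarrow> complex) \<Rightarrow> nat \<Rightarrow> nat \<Rightarrow> complex" where
  "hat_comb \<nu> j i = (if i \<le> j then \<nu> i j else 0)"

definition orthonormal_basis_coeffs :: "nat \<Rightarrow> (nat \<Rightarrow> nat \<Rightarrow> complex) \<Rightarrow> bool" where
  "orthonormal_basis_coeffs N \<nu> \<longleftrightarrow>
    (\<forall>c. is_zero_comb N (\<lambda>i. \<Sum>j=1..N-1. c j * hat_comb \<nu> j i) \<longrightarrow> (\<forall>j\<in>{1..N-1}. c j = 0)) \<and>
    (\<forall>x. \<exists>c. is_zero_comb N (\<lambda>i. x i - (\<Sum>j=1..N-1. c j * hat_comb \<nu> j i))) \<and>
    (\<forall>j\<in>{1..N-1}. \<forall>k\<in>{1..N-1}.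
      comb_form N (hat_comb \<nu> j) (hat_comb \<nu> k) = (if j = k then 1 else 0))"

text \<open>From here on \<open>GY j r\<close> stands for the generator with the hat, where \<open>j \<in> {1..N-1}\<close>.\<close>

definition hat_gens :: "nat \<Rightarrow> gen set" where
  "hat_gens N = {GC} \<union> {GY j r | j r. j \<in> {1..N-1} \<and> r \<noteq> 0}"

fun hat_gen :: "nat \<Rightarrow> (nat \<Rightarrow> nat \<Rightarrow> complex) \<Rightarrow> gen \<Rightarrow> gen free_series set" where
  "hat_gen N \<nu> GC = H_gen N GC"
| "hat_gen N \<nu> (GY j r) =
    (\<Oplus>\<^bsub>H_algebra N\<^esub> i \<in> {1..j}. fps_const (\<nu> i j) \<odot>\<^bsub>H_algebra N\<^esub> H_gen N (GY i r))"

fun gen_less :: "gen \<Rightarrow> gen \<Rightarrow> bool" where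
  "gen_less GC GC \<longleftrightarrow> False"
| "gen_less GC (GY j r) \<longleftrightarrow> True"
| "gen_less (GY i s) GC \<longleftrightarrow> False"
| "gen_less (GY i s) (GY j r) \<longleftrightarrow> s < r \<or> s = r \<and> i < j"

text \<open>
  The list \<open>[m\<^sub>n, ..., m\<^sub>1]\<close> represents the monomial m_n ... m_1.
\<close>

definition increasing_words :: "nat \<Rightarrow> gen list set" where
  "increasing_words N =
    {ms. set ms \<subseteq> hat_gens N \<and> sorted_wrt (\<lambda>a b. gen_less a b \<or> a = b) ms}"

definition monomial :: "nat \<Rightarrow> (nat \<Rightarrow> nat \<Rightarrow> complex) \<Rightarrow> gen list \<Rightarrow> gen free_series set" where
  "monomial N \<nu> ms =
    foldr (\<lambda>m x. hat_gen N \<nu> m \<otimes>\<^bsub>H_algebra N\<^esub> x) ms \<one>\<^bsub>H_algebra N\<^esub>"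


section \<open>Topological bases over C[[h]]\<close>

definition lin_indep_family :: "(complex fps, 'a, 'm) module_scheme \<Rightarrow> 'i set \<Rightarrow> ('i \<Rightarrow> 'a) \<Rightarrow> bool" where
  "lin_indep_family M I e \<longleftrightarrow>
    (\<forall>A c. finite A \<and> A \<subseteq> I \<and> (\<Oplus>\<^bsub>M\<^esub> i \<in> A. c i \<odot>\<^bsub>M\<^esub> e i) = \<zero>\<^bsub>M\<^esub> \<longrightarrow> (\<forall>i\<in>A. c i = 0))"

definition dense_span :: "(complex fps, 'a, 'm) module_scheme \<Rightarrow> 'i set \<Rightarrow> ('i \<Rightarrow> 'a) \<Rightarrow> bool" where
  "dense_span M I e \<longleftrightarrow>
    (\<forall>x \<in> carrier M. \<forall>n. \<exists>A c. finite A \<and> A \<subseteq> I \<and>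
      (\<exists>z \<in> carrier M. x = (\<Oplus>\<^bsub>M\<^esub> i \<in> A. c i \<odot>\<^bsub>M\<^esub> e i) \<oplus>\<^bsub>M\<^esub> fps_X ^ n \<odot>\<^bsub>M\<^esub> z))"

definition topological_basis_family ::
  "(complex fps, 'a, 'm) module_scheme \<Rightarrow> 'i set \<Rightarrow> ('i \<Rightarrow> 'a) \<Rightarrow> bool" where
  "topological_basis_family M I e \<longleftrightarrow>
    e ` I \<subseteq> carrier M \<and> lin_indep_family M I e \<and> dense_span M I e"

end

theory Submission
  imports Defs "HOL-Library.Multiset"
begin

text \<open>
  All s_{ij} are multiples \<open>\<delta>\<^sub>i\<^sub>j - 1/N = \<langle>a\<^sub>i, a\<^sub>j\<rangle>\<close> of a single series, so in the generators with the hat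
  the quadratic relations say that the commutator of \<open>y\<^sub>j\<^sup>r\<close> and \<open>y\<^sub>k\<^sup>s\<close> is \<open>\<delta>\<^sub>j\<^sub>k \<gamma> r s\<close> with an
  antisymmetric central \<open>\<gamma>\<close>. Density: modulo h^n, multiplying an increasing monomial from the left
  by a generator inserts the generator at its place, up to C[C]-combinations of increasing monomials
  in the old letters. Independence: let \<open>y\<^sub>j\<^sup>r\<close> act on polynomials over C[C][[h]] in variables
  indexed by (j,r) as multiplication by the variable (j,r) plus the derivation that maps (j,s) to
  \<open>\<gamma> r s\<close> for \<open>s < r\<close> and all other variables to 0. An increasing monomial then maps 1 to the
  corresponding commutative monomial, because its letters are applied from the greatest to the
  smallest and no derivation contributes.
\<close>

text \<open>At h = 0 the bracket of y_i^(r) and y_j^(s) becomes r C <a_i, a_j> if r + s = 0 and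
  vanishes otherwise: the Heisenberg relations with C as level. The module of the independence proof
  is a relative of the Fock space. In a Fock space half of the generators annihilate the vacuum;
  here every generator with the hat multiplies by a variable of its own, so that the values of the
  increasing monomials at 1 are already independent. Each bracket is realised by the derivation of
  only one of the two generators, and the order on the generators decides of which. C stays a
  variable of the scalars, because its powers have to be separated as well. The remaining obstacle
  is the completion: elements are infinite series in h and the ideal is closed. It is met one
  coefficient at a time: the coefficient of h^n in an action depends only on the acting element
  modulo h^(n+1), so an action that kills the relators kills the closed ideal too.\<close>

section \<open>The series S\<close>

text \<open>
  The substitution of h/u for h. It maps -h/(1+hC) to h/(-u-hC).
\<close>

definition homog :: "complex poly fps \<Rightarrow> coeff_ring" where
  "homog g = Abs_fps (\<lambda>n. monom (g $ n) n)"

lemma homog_nth [simp]: "homog g $ n = monom (g $ n) n"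
  by (simp add: homog_def)

lemma homog_add: "homog (f + g) = homog f + homog g"
  by (rule fps_ext) (simp add: add_monom)

lemma homog_diff: "homog (f - g) = homog f - homog g"
  by (rule fps_ext) (simp add: diff_monom)

lemma homog_1: "homog 1 = 1"
  by (rule fps_ext) (simp add: monom_0 one_pCons)

lemma homog_mult: "homog (f * g) = homog f * homog g"
proof (rule fps_ext)
  fix n
  have "monom (\<Sum>i=0..n. f $ i * g $ (n - i)) n = (\<Sum>i=0..n. monom (f $ i * g $ (n - i)) n)"
    by (rule poly_eqI) (simp add: coeff_sum)
  also have "\<dots> = (\<Sum>i=0..n. monom (f $ i) i * monom (g $ (n - i)) (n - i))"
    by (rule sum.cong) (auto simp: mult_monom)
  finally show "homog (f * g) $ n = (homog f * homog g) $ n"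
    by (simp add: fps_mult_nth)
qed

lemma homog_of_nat: "homog (of_nat n) = of_nat n"
  by (induction n) (simp_all add: homog_add homog_1, simp add: homog_def fps_ext)

definition minus_hC_inv_scaled :: "complex poly fps" where
  "minus_hC_inv_scaled = Abs_fps (\<lambda>k. if k = 0 then 0 else monom ((-1) ^ k) (k - 1))"

lemma homog_fps_X: "homog fps_X = fps_X * u_inv"
  by (rule fps_ext) (auto simp: fps_X_nth)

lemma homog_minus_hC_inv_scaled: "homog minus_hC_inv_scaled = fps_X * minus_u_hC_inv"
proof (rule fps_ext)
  fix n
  show "homog minus_hC_inv_scaled $ n = (fps_X * minus_u_hC_inv) $ n"
    by (cases n) (simp_all add: minus_hC_inv_scaled_def minus_u_hC_inv_def)
qed

text \<open>P squares to the identity, so (I - aP)(I - bP) = (1 + ab) I - (a + b) P. In coordinates,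
  multiplication by P from the left exchanges the first and the third index.\<close>

lemma mult_op_R_op:
  assumes "i \<in> {1..N}" "j \<in> {1..N}" "k \<in> {1..N}" "l \<in> {1..N}"
  shows "mult_op N (R_op x) (R_op y) i j k l =
    (1 + (fps_X * x) * (fps_X * y)) * id_op i j k l
      - (fps_X * x + fps_X * y) * perm_op i j k l"
proof -
  have *: "R_op x i p k q * R_op y p j q l =
     (if i = p then if k = q then R_op y p j q l else 0 else 0)
     - (if k = p then if i = q then fps_X * x * R_op y p j q l else 0 else 0)" for p q
    unfolding R_op_def[of x] by (simp add: id_op_def perm_op_def left_diff_distrib)
  have inner: "(\<Sum>q=1..N. R_op x i p k q * R_op y p j q l) =
      (if i = p then R_op y p j k l else 0) - (if k = p then fps_X * x * R_op y p j i l else 0)" for p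
    unfolding * sum_subtractf using assms by (cases "i = p"; cases "k = p") (simp_all add: sum.delta')
  have "mult_op N (R_op x) (R_op y) i j k l = R_op y i j k l - fps_X * x * R_op y k j i l"
    unfolding mult_op_def inner sum_subtractf using assms by (simp add: sum.delta')
  moreover have "id_op k j i l = (perm_op i j k l :: coeff_ring)"
    "perm_op k j i l = (id_op i j k l :: coeff_ring)"
    unfolding id_op_def perm_op_def by (rule if_cong; blast)+
  ultimately show ?thesis
    by (simp only: R_op_def) (simp add: algebra_simps)
qed

text \<open>This and \<open>yang_perm\<close> are the factors of I and of -P in R(u) R(-u-hC), as
  series in h/u.\<close>

definition yang_diag :: "complex poly fps" where
  "yang_diag = 1 + fps_X * minus_hC_inv_scaled"

definition yang_perm :: "complex poly fps" where
  "yang_perm = fps_X + minus_hC_inv_scaled"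

lemma GRR_minus_id_eq:
  assumes "i \<in> {1..N}" "j \<in> {1..N}" "k \<in> {1..N}" "l \<in> {1..N}"
  shows "GRR_minus_id N G i j k l =
    G * (homog yang_diag * id_op i j k l - homog yang_perm * perm_op i j k l) - id_op i j k l"
  unfolding GRR_minus_id_def mult_op_R_op[OF assms] yang_diag_def yang_perm_def
  by (simp add: homog_add homog_mult homog_1 homog_fps_X homog_minus_hC_inv_scaled)

section \<open>The trace conditions and the series G\<close>

lemma trace1_GRR_minus_id:
  assumes "k \<in> {1..N}" "l \<in> {1..N}"
  shows "trace1 N (GRR_minus_id N G) k l =
    (if k = l then G * (of_nat N * homog yang_diag - homog yang_perm) - of_nat N else 0)"
proof -
  have "trace1 N (GRR_minus_id N G) k l =
    (\<Sum>i=1..N. (if k = l then G * homog yang_diag - 1 else 0)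
       - (if i = k then if k = l then G * homog yang_perm else 0 else 0))"
    unfolding trace1_def
    by (rule sum.cong) (use assms in \<open>auto simp: GRR_minus_id_eq id_op_def perm_op_def algebra_simps\<close>)
  then show ?thesis
    using assms by (cases "k = l") (simp_all add: sum_subtractf right_diff_distrib mult.left_commute)
qed

lemma trace2_GRR_minus_id:
  assumes "i \<in> {1..N}" "j \<in> {1..N}"
  shows "trace2 N (GRR_minus_id N G) i j =
    (if i = j then G * (of_nat N * homog yang_diag - homog yang_perm) - of_nat N else 0)"
proof -
  have "trace2 N (GRR_minus_id N G) i j =
    (\<Sum>k=1..N. (if i = j then G * homog yang_diag - 1 else 0)
       - (if k = i then if i = j then G * homog yang_perm else 0 else 0))"
    unfolding trace2_def
    by (rule sum.cong) (use assms in \<open>auto simp: GRR_minus_id_eq id_op_def perm_op_def algebra_simps\<close>)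
  then show ?thesis
    using assms by (cases "i = j") (simp_all add: sum_subtractf right_diff_distrib mult.left_commute)
qed

text \<open>Over either factor the partial traces of I and P are N and 1 times the identity, so all
  trace conditions collapse to one scalar equation.\<close>

lemma is_G_series_iff:
  assumes "1 \<le> N"
  shows "is_G_series N G \<longleftrightarrow>
    (\<exists>g. G = homog g) \<and> G * (of_nat N * homog yang_diag - homog yang_perm) = of_nat N"
proof -
  let ?x = "G * (of_nat N * homog yang_diag - homog yang_perm) - of_nat N"
  have 1: "(\<forall>k\<in>{1..N}. \<forall>l\<in>{1..N}. trace1 N (GRR_minus_id N G) k l = 0) \<longleftrightarrow>
      (\<forall>k\<in>{1..N}. \<forall>l\<in>{1..N}. (if k = l then ?x else 0) = 0)"
    by (intro ball_cong refl) (simp only: trace1_GRR_minus_id)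
  have 2: "(\<forall>i\<in>{1..N}. \<forall>j\<in>{1..N}. trace2 N (GRR_minus_id N G) i j = 0) \<longleftrightarrow>
      (\<forall>i\<in>{1..N}. \<forall>j\<in>{1..N}. (if i = j then ?x else 0) = 0)"
    by (intro ball_cong refl) (simp only: trace2_GRR_minus_id)
  have 3: "(\<forall>k\<in>{1..N}. \<forall>l\<in>{1..N}. (if k = l then x else 0) = 0) \<longleftrightarrow> x = 0" for x :: coeff_ring
    using assms by auto
  show ?thesis
    unfolding is_G_series_def homog_def[symmetric] 1 2 3 by simp
qed

lemma is_G_series_G_series:
  assumes "1 \<le> N"
  shows "is_G_series N (G_series N)"
proof -
  define d where "d = of_nat N * yang_diag - yang_perm"
  have d: "of_nat N * homog yang_diag - homog yang_perm = homog d"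
    by (simp add: d_def homog_diff homog_mult homog_of_nat)
  have d0: "d $ 0 = of_nat N"
    by (simp add: d_def yang_diag_def yang_perm_def minus_hC_inv_scaled_def)
  \<comment> \<open>The constant term N of \<open>d\<close> is a unit of C[C], so the inverse exists
    although the coefficients do not form a field.\<close>
  define e where "e = fps_right_inverse d [:1 / of_nat N:]"
  have "d * e = 1" unfolding e_def
    by (rule fps_right_inverse) (use assms d0 in \<open>simp add: of_nat_poly one_pCons\<close>)
  then have "of_nat N * e * d = of_nat N" by (simp add: mult.assoc mult.commute[of e])
  then have ex: "is_G_series N (homog (of_nat N * e))"
    unfolding is_G_series_iff[OF assms] d homog_mult[symmetric] by (metis homog_of_nat)
  have "homog d \<noteq> 0"
  proof
    assume "homog d = 0"
    then have "homog d $ 0 = 0" by simp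
    then show False using d0 assms by simp
  qed
  have "\<exists>!G. is_G_series N G"
  proof (rule ex_ex1I)
    show "\<exists>G. is_G_series N G" using ex by blast
    fix G G' assume "is_G_series N G" "is_G_series N G'"
    then have "G * homog d = G' * homog d" using assms by (simp add: is_G_series_iff d)
    then show "G = G'" using \<open>homog d \<noteq> 0\<close> by simp
  qed
  then show ?thesis unfolding G_series_def by (rule theI')
qed

text \<open>Let E be G times the factor \<open>yang_perm\<close>. By the trace equation the factor
  of I in G R(u) R(-u-hC) is 1 + E/N, hence h^2 S = E (I/N - P). So -E is what remains of the
  diagonal entries after \<delta>_ij - 1/N is split off; being a series in h/u, it is determined by
  one element of C[C] for each power of h.\<close>

definition s_factor :: "nat \<Rightarrow> complex poly fps" where
  "s_factor N = Abs_fps (\<lambda>n. - coeff ((G_series N * homog yang_perm) $ (n + 2)) (n + 2))"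

lemma s_series_nth:
  assumes "1 \<le> N" "i \<in> {1..N}" "j \<in> {1..N}"
  shows "s_series N i j $ n =
     monom ([:(if i = j then 1 else 0) - 1 / of_nat N:] * s_factor N $ n) (n + 2)"
proof -
  obtain g where g: "G_series N = homog g"
    and *: "homog g * (of_nat N * homog yang_diag - homog yang_perm) = of_nat N"
    using is_G_series_G_series[OF assms(1)] assms(1) by (auto simp: is_G_series_iff)
  define E where "E = g * yang_perm"
  define c where "c = fps_const [:[:1 / of_nat N :: complex:]:]"
  have c: "c * of_nat N = 1"
    using assms(1) by (simp add: c_def fps_of_nat[symmetric] of_nat_poly one_pCons del: fps_of_nat)
  have "of_nat N * (homog g * homog yang_diag - 1) = homog E"
    using * by (simp add: E_def homog_mult algebra_simps)
  then have "c * (of_nat N * (homog g * homog yang_diag - 1)) = c * homog E" by simp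
  then have D: "homog g * homog yang_diag - 1 = c * homog E"
    by (simp add: c flip: mult.assoc)
  have "GRR_minus_id N (G_series N) i i j j = c * homog E - (if i = j then homog E else 0)"
    using assms D
    by (auto simp: g GRR_minus_id_eq id_op_def perm_op_def E_def homog_mult algebra_simps)
  moreover have "s_factor N $ n = - E $ (n + 2)"
    unfolding s_factor_def g homog_mult[symmetric] E_def[symmetric] by simp
  ultimately show ?thesis
    by (intro poly_eqI) (simp add: s_series_def c_def left_diff_distrib)
qed

section \<open>Completed algebras given by a presentation\<close>

definition letters_in :: "'g set \<Rightarrow> ('g fword \<Rightarrow>\<^sub>0 complex) \<Rightarrow> bool" where
  "letters_in X p \<longleftrightarrow> (\<forall>w\<in>Poly_Mapping.keys p. set (letters w) \<subseteq> X)"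

abbreviation free_carrier :: "'g set \<Rightarrow> 'g free_series set" where
  "free_carrier X \<equiv> carrier (completed_free_algebra X)"

lemma mem_free_carrier: "f \<in> free_carrier X \<longleftrightarrow> (\<forall>k. letters_in X (f $ k))"
  by (simp add: completed_free_algebra_def letters_in_def)

lemma completed_free_algebra_simps [simp]:
  "f \<otimes>\<^bsub>completed_free_algebra X\<^esub> g = f * g"
  "f \<oplus>\<^bsub>completed_free_algebra X\<^esub> g = f + g"
  "\<one>\<^bsub>completed_free_algebra X\<^esub> = 1"
  "\<zero>\<^bsub>completed_free_algebra X\<^esub> = 0"
  by (simp_all add: completed_free_algebra_def)

lemma letters_in_0 [simp]: "letters_in X 0"
  by (simp add: letters_in_def)

lemma letters_in_1 [simp]: "letters_in X 1"
  by (simp add: letters_in_def zero_fword_def)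

lemma letters_in_single: "set (letters w) \<subseteq> X \<Longrightarrow> letters_in X (Poly_Mapping.single w c)"
  by (simp add: letters_in_def)

lemma letters_in_add: "letters_in X p \<Longrightarrow> letters_in X q \<Longrightarrow> letters_in X (p + q)"
  using keys_add[of p q] by (auto simp: letters_in_def)

lemma letters_in_uminus: "letters_in X p \<Longrightarrow> letters_in X (- p)"
  by (simp add: letters_in_def)

lemma letters_in_sum: "(\<And>i. i \<in> A \<Longrightarrow> letters_in X (p i)) \<Longrightarrow> letters_in X (sum p A)"
  by (induction A rule: infinite_finite_induct) (auto intro: letters_in_add)

lemma letters_in_mult:
  assumes "letters_in X p" "letters_in X q"
  shows "letters_in X (p * q)"
  unfolding letters_in_def
proof
  fix w assume "w \<in> Poly_Mapping.keys (p * q)"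
  then obtain a b where "w = a + b" "a \<in> Poly_Mapping.keys p" "b \<in> Poly_Mapping.keys q"
    using keys_mult[of p q] by blast
  then show "set (letters w) \<subseteq> X"
    using assms by (auto simp: letters_in_def plus_fword_def)
qed

lemma free_carrier_0 [simp]: "0 \<in> free_carrier X"
  by (simp add: mem_free_carrier)

lemma free_carrier_1 [simp]: "1 \<in> free_carrier X"
  by (simp add: mem_free_carrier)

lemma free_carrier_add [simp]:
  "f \<in> free_carrier X \<Longrightarrow> g \<in> free_carrier X \<Longrightarrow> f + g \<in> free_carrier X"
  by (simp add: mem_free_carrier letters_in_add)

lemma free_carrier_uminus [simp]: "f \<in> free_carrier X \<Longrightarrow> - f \<in> free_carrier X"
  by (simp add: mem_free_carrier letters_in_uminus)

lemma free_carrier_diff [simp]: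
  "f \<in> free_carrier X \<Longrightarrow> g \<in> free_carrier X \<Longrightarrow> f - g \<in> free_carrier X"
  using free_carrier_add[of f X "- g"] by simp

lemma free_carrier_mult [simp]:
  "f \<in> free_carrier X \<Longrightarrow> g \<in> free_carrier X \<Longrightarrow> f * g \<in> free_carrier X"
  by (auto simp: mem_free_carrier fps_mult_nth intro!: letters_in_sum letters_in_mult)

lemma free_carrier_sum [simp]:
  "(\<And>i. i \<in> A \<Longrightarrow> f i \<in> free_carrier X) \<Longrightarrow> sum f A \<in> free_carrier X"
  by (induction A rule: infinite_finite_induct) auto

lemma free_carrier_fps_X_power [simp]: "fps_X ^ n \<in> free_carrier X"
  by (simp add: mem_free_carrier)

lemma free_carrier_gen_series [simp]: "g \<in> X \<Longrightarrow> gen_series g \<in> free_carrier X"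
  by (auto simp: mem_free_carrier gen_series_def letters_in_single)

lemma free_carrier_scalar_series [simp]: "scalar_series c \<in> free_carrier X"
  by (simp add: mem_free_carrier scalar_series_def letters_in_single zero_fword_def)

lemma single_sum: "Poly_Mapping.single k (sum f A) = (\<Sum>i\<in>A. Poly_Mapping.single k (f i))"
  by (induction A rule: infinite_finite_induct) (auto simp: single_add)

lemma scalar_series_add: "scalar_series (c + d) = scalar_series c + scalar_series d"
  by (rule fps_ext) (simp add: scalar_series_def single_add)

lemma scalar_series_uminus: "scalar_series (- c) = - scalar_series c"
  by (rule fps_ext) (simp add: scalar_series_def single_uminus)

lemma scalar_series_sum: "scalar_series (sum c A) = (\<Sum>i\<in>A. scalar_series (c i))"
  by (rule fps_ext) (simp add: scalar_series_def fps_sum_nth single_sum)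

lemma fps_const_sum: "fps_const (sum c A) = (\<Sum>i\<in>A. fps_const (c i))"
  by (rule fps_ext) (simp add: fps_sum_nth)

lemma scalar_series_0 [simp]: "scalar_series 0 = 0"
  by (rule fps_ext) (simp add: scalar_series_def)

lemma scalar_series_1 [simp]: "scalar_series 1 = 1"
  by (rule fps_ext) (simp add: scalar_series_def)

lemma scalar_series_mult: "scalar_series (c * d) = scalar_series c * scalar_series d"
  by (rule fps_ext) (simp add: scalar_series_def fps_mult_nth mult_single single_sum)

lemma scalar_series_fps_X_power: "scalar_series (fps_X ^ n) = fps_X ^ n"
  by (rule fps_ext) (simp add: scalar_series_def)

lemma single_expansion:
  "p = (\<Sum>w\<in>Poly_Mapping.keys p. Poly_Mapping.single w (Poly_Mapping.lookup p w))"
  by (rule poly_mapping_eqI)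
    (auto simp: lookup_sum lookup_single when_def not_in_keys_iff_lookup_eq_zero[symmetric] sum.delta)

lemma single_0_mult_commute: "Poly_Mapping.single 0 c * p = p * Poly_Mapping.single (0 :: 'g fword) (c :: complex)"
proof -
  have "Poly_Mapping.single 0 c * (\<Sum>w\<in>A. Poly_Mapping.single w (Poly_Mapping.lookup p w)) =
    (\<Sum>w\<in>A. Poly_Mapping.single w (Poly_Mapping.lookup p w)) * Poly_Mapping.single 0 c" for A
    by (simp add: sum_distrib_left sum_distrib_right mult_single mult.commute)
  then show ?thesis by (metis single_expansion)
qed

text \<open>The monoid algebra is not commutative, so this rests on the centrality of complex
  numbers in each coefficient and on reversing the Cauchy product.\<close>

lemma scalar_series_commute: "scalar_series c * f = f * scalar_series c"
proof (rule fps_ext)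
  fix n
  have "(scalar_series c * f) $ n = (\<Sum>i\<in>{0..n}. f $ (n - i) * scalar_series c $ i)"
    by (simp add: scalar_series_def fps_mult_nth single_0_mult_commute)
  also have "\<dots> = (\<Sum>i\<in>{0..n}. f $ i * scalar_series c $ (n - i))"
    by (rule sum.reindex_bij_witness[of _ "\<lambda>i. n - i" "\<lambda>i. n - i"]) auto
  finally show "(scalar_series c * f) $ n = (f * scalar_series c) $ n"
    by (simp add: fps_mult_nth)
qed

lemma fps_const_single:
  fixes gs :: "'g list"
  shows "fps_const (Poly_Mapping.single (FWord gs) c) =
    scalar_series (fps_const c) * prod_list (map gen_series gs)"
proof -
  have "prod_list (map gen_series gs) = fps_const (Poly_Mapping.single (FWord gs) 1)"
  proof (induction gs)
    case Nil
    then show ?case by (simp add: zero_fword_def[symmetric])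
  next
    case (Cons g gs)
    then show ?case by (simp add: gen_series_def mult_single plus_fword_def)
  qed
  moreover have "(scalar_series (fps_const c) :: 'g free_series) = fps_const (Poly_Mapping.single 0 c)"
    by (rule fps_ext) (simp add: scalar_series_def)
  ultimately show ?thesis by (simp add: mult_single)
qed

lemma ring_completed_free_algebra: "ring (completed_free_algebra X)"
proof (rule ringI)
  show "abelian_group (completed_free_algebra X)"
    by (rule abelian_groupI) (auto simp: add.assoc add.commute intro!: bexI[of _ "- x" for x])
  show "Group.monoid (completed_free_algebra X)"
    by (rule monoidI) (auto simp: mult.assoc)
qed (auto simp: distrib_left distrib_right)

lemma a_inv_completed_free_algebra:
  assumes "f \<in> free_carrier X"
  shows "\<ominus>\<^bsub>completed_free_algebra X\<^esub> f = - f"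
proof -
  interpret ring "completed_free_algebra X" by (rule ring_completed_free_algebra)
  show ?thesis by (rule minus_equality) (use assms in simp_all)
qed

lemma a_minus_completed_free_algebra:
  assumes "f \<in> free_carrier X" "g \<in> free_carrier X"
  shows "f \<ominus>\<^bsub>completed_free_algebra X\<^esub> g = f - g"
  using assms by (simp add: a_minus_def a_inv_completed_free_algebra)

section \<open>The closed ideal and the quotient by it\<close>

locale presentation =
  fixes X :: "'g set" and rels :: "'g free_series set"
  assumes rels_subset: "rels \<subseteq> free_carrier X"
begin

sublocale F: ring "completed_free_algebra X"
  by (rule ring_completed_free_algebra)

abbreviation "J \<equiv> closed_ideal X rels"

abbreviation "H \<equiv> presented_algebra X rels"

definition cls :: "'g free_series \<Rightarrow> 'g free_series set" where
  "cls f = J +>\<^bsub>completed_free_algebra X\<^esub> f"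

lemma ideal_genideal: "ideal (Idl\<^bsub>completed_free_algebra X\<^esub> rels) (completed_free_algebra X)"
  using rels_subset by (rule F.genideal_ideal)

lemma genideal_subset_J: "a \<in> Idl\<^bsub>completed_free_algebra X\<^esub> rels \<Longrightarrow> a \<in> J"
  using ideal.Icarr[OF ideal_genideal, of a] unfolding closed_ideal_def
  by (intro CollectI conjI allI bexI[of _ a] bexI[of _ 0]) simp_all

lemma rels_in_J: "a \<in> rels \<Longrightarrow> a \<in> J"
  using F.genideal_self[OF rels_subset] genideal_subset_J by blast

lemma J_subset_carrier: "f \<in> J \<Longrightarrow> f \<in> free_carrier X"
  by (simp add: closed_ideal_def)

lemma J_E:
  assumes "f \<in> J"
  obtains a b where "a \<in> Idl\<^bsub>completed_free_algebra X\<^esub> rels" "b \<in> free_carrier X" "f = a + fps_X ^ n * b"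
  using assms unfolding closed_ideal_def by blast

lemma J_I:
  assumes "f \<in> free_carrier X"
    and "\<And>n. \<exists>a b. a \<in> Idl\<^bsub>completed_free_algebra X\<^esub> rels \<and> b \<in> free_carrier X \<and> f = a + fps_X ^ n * b"
  shows "f \<in> J"
  using assms unfolding closed_ideal_def by blast

lemma J_0: "0 \<in> J"
  using additive_subgroup.zero_closed[OF ideal.axioms(1)[OF ideal_genideal]] genideal_subset_J
  by simp

lemma J_add: assumes "f \<in> J" "g \<in> J" shows "f + g \<in> J"
proof (rule J_I)
  show "f + g \<in> free_carrier X" using assms J_subset_carrier by simp
  fix n
  obtain a b where a: "a \<in> Idl\<^bsub>completed_free_algebra X\<^esub> rels" "b \<in> free_carrier X" "f = a + fps_X ^ n * b"
    using assms(1) by (rule J_E)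
  obtain a' b' where b: "a' \<in> Idl\<^bsub>completed_free_algebra X\<^esub> rels" "b' \<in> free_carrier X" "g = a' + fps_X ^ n * b'"
    using assms(2) by (rule J_E)
  have "a + a' \<in> Idl\<^bsub>completed_free_algebra X\<^esub> rels"
    using additive_subgroup.a_closed[OF ideal.axioms(1)[OF ideal_genideal] a(1) b(1)] by simp
  then show "\<exists>a b. a \<in> Idl\<^bsub>completed_free_algebra X\<^esub> rels \<and> b \<in> free_carrier X \<and> f + g = a + fps_X ^ n * b"
    using a b by (intro exI[of _ "a + a'"] exI[of _ "b + b'"]) (simp add: algebra_simps)
qed

lemma J_mult_left: assumes "f \<in> free_carrier X" "g \<in> J" shows "f * g \<in> J"
proof (rule J_I)
  show "f * g \<in> free_carrier X" using assms J_subset_carrier by simp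
  fix n
  obtain a b where a: "a \<in> Idl\<^bsub>completed_free_algebra X\<^esub> rels" "b \<in> free_carrier X" "g = a + fps_X ^ n * b"
    using assms(2) by (rule J_E)
  have "f * a \<in> Idl\<^bsub>completed_free_algebra X\<^esub> rels"
    using ideal.I_l_closed[OF ideal_genideal a(1) assms(1)] by simp
  moreover have "f * g = f * a + fps_X ^ n * (f * b)"
    using fps_mult_fps_X_power_commute[of n f] by (simp add: a(3) distrib_left mult.assoc[symmetric])
  ultimately show "\<exists>a b. a \<in> Idl\<^bsub>completed_free_algebra X\<^esub> rels \<and> b \<in> free_carrier X \<and> f * g = a + fps_X ^ n * b"
    using a assms by (intro exI[of _ "f * a"] exI[of _ "f * b"]) simp
qed

lemma J_mult_right: assumes "f \<in> J" "g \<in> free_carrier X" shows "f * g \<in> J"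
proof (rule J_I)
  show "f * g \<in> free_carrier X" using assms J_subset_carrier by simp
  fix n
  obtain a b where a: "a \<in> Idl\<^bsub>completed_free_algebra X\<^esub> rels" "b \<in> free_carrier X" "f = a + fps_X ^ n * b"
    using assms(1) by (rule J_E)
  have "a * g \<in> Idl\<^bsub>completed_free_algebra X\<^esub> rels"
    using ideal.I_r_closed[OF ideal_genideal a(1) assms(2)] by simp
  moreover have "f * g = a * g + fps_X ^ n * (b * g)"
    by (simp add: a(3) distrib_right mult.assoc)
  ultimately show "\<exists>a b. a \<in> Idl\<^bsub>completed_free_algebra X\<^esub> rels \<and> b \<in> free_carrier X \<and> f * g = a + fps_X ^ n * b"
    using a assms by (intro exI[of _ "a * g"] exI[of _ "b * g"]) simp
qed

lemma J_uminus: "f \<in> J \<Longrightarrow> - f \<in> J"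
  using J_mult_left[of "- 1" f] by simp

lemma J_sum: "(\<And>i. i \<in> A \<Longrightarrow> f i \<in> J) \<Longrightarrow> sum f A \<in> J"
  by (induction A rule: infinite_finite_induct) (auto intro: J_0 J_add)

lemma ideal_J: "ideal J (completed_free_algebra X)"
proof (rule idealI)
  show "subgroup J (add_monoid (completed_free_algebra X))"
  proof (rule group.subgroupI)
    show "Group.group (add_monoid (completed_free_algebra X))" by (rule F.a_group)
    show "J \<subseteq> carrier (add_monoid (completed_free_algebra X))" using J_subset_carrier by auto
    show "J \<noteq> {}" using J_0 by blast
    show "inv\<^bsub>add_monoid (completed_free_algebra X)\<^esub> a \<in> J" if "a \<in> J" for a
      using that a_inv_completed_free_algebra[of a X] J_subset_carrier J_uminus
      by (simp add: a_inv_def)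
    show "a \<otimes>\<^bsub>add_monoid (completed_free_algebra X)\<^esub> b \<in> J" if "a \<in> J" "b \<in> J" for a b
      using that J_add by simp
  qed
qed (auto simp: ring_completed_free_algebra J_mult_left J_mult_right)

sublocale J: ideal J "completed_free_algebra X"
  by (rule ideal_J)

lemma cls_eq_iff:
  "f \<in> free_carrier X \<Longrightarrow> g \<in> free_carrier X \<Longrightarrow> cls f = cls g \<longleftrightarrow> f - g \<in> J"
  using F.quotient_eq_iff_same_a_r_cos[OF ideal_J, of f g]
  by (simp add: cls_def a_minus_completed_free_algebra)

lemma H_simps:
  "carrier H = carrier (completed_free_algebra X Quot J)"
  "mult H = mult (completed_free_algebra X Quot J)"
  "one H = one (completed_free_algebra X Quot J)"
  "zero H = zero (completed_free_algebra X Quot J)"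
  "add H = add (completed_free_algebra X Quot J)"
  "smult H = (\<lambda>c x. cls (scalar_series c) \<otimes>\<^bsub>H\<^esub> x)"
  by (simp_all add: presented_algebra_def cls_def Let_def)

lemma carrier_H: "carrier H = cls ` free_carrier X"
  by (auto simp: H_simps(1) FactRing_def A_RCOSETS_def' cls_def)

lemma cls_ring_hom: "cls \<in> ring_hom (completed_free_algebra X) H"
proof -
  have "cls = (+>\<^bsub>completed_free_algebra X\<^esub>) J" by (simp add: cls_def fun_eq_iff)
  then show ?thesis using J.rcos_ring_hom by (simp add: ring_hom_def H_simps)
qed

lemma cls_mult: "f \<in> free_carrier X \<Longrightarrow> g \<in> free_carrier X \<Longrightarrow> cls f \<otimes>\<^bsub>H\<^esub> cls g = cls (f * g)"
  using ring_hom_mult[OF cls_ring_hom] by simp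

lemma cls_add: "f \<in> free_carrier X \<Longrightarrow> g \<in> free_carrier X \<Longrightarrow> cls f \<oplus>\<^bsub>H\<^esub> cls g = cls (f + g)"
  using ring_hom_add[OF cls_ring_hom] by simp

lemma cls_1: "\<one>\<^bsub>H\<^esub> = cls 1"
  using ring_hom_one[OF cls_ring_hom] by simp

lemma cls_0: "\<zero>\<^bsub>H\<^esub> = cls 0"
  using F.a_rcos_zero[OF ideal_J J_0] by (simp add: H_simps FactRing_def cls_def)

lemma cls_smult: "f \<in> free_carrier X \<Longrightarrow> c \<odot>\<^bsub>H\<^esub> cls f = cls (scalar_series c * f)"
  by (simp add: H_simps(6) cls_mult)

lemma ring_H: "ring H"
proof -
  have "H\<lparr>carrier := cls ` free_carrier X, zero := cls \<zero>\<^bsub>completed_free_algebra X\<^esub>\<rparr> = H"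
    by (simp flip: carrier_H cls_0)
  then show ?thesis
    using F.ring_hom_imp_img_ring[OF cls_ring_hom] by simp
qed

lemma cls_finsum:
  assumes "\<And>i. i \<in> A \<Longrightarrow> f i \<in> free_carrier X" and "\<And>i. i \<in> A \<Longrightarrow> e i = cls (f i)" and "finite A"
  shows "(\<Oplus>\<^bsub>H\<^esub> i\<in>A. e i) = cls (\<Sum>i\<in>A. f i)"
proof -
  interpret H: ring H by (rule ring_H)
  show ?thesis
    using assms(3,1,2)
  proof (induction A rule: finite_induct)
    case empty
    then show ?case by (simp add: cls_0)
  next
    case (insert a A)
    then show ?case
      by (subst H.finsum_insert) (auto simp: carrier_H cls_add)
  qed
qed

text \<open>Confines the work with cosets to this place: what remains to be shown are congruences
  modulo \<open>J\<close> between representatives \<open>m i\<close> in the completed free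
  algebra.\<close>

lemma topological_basis_familyI:
  assumes e: "\<And>i. i \<in> I \<Longrightarrow> m i \<in> free_carrier X" "\<And>i. i \<in> I \<Longrightarrow> e i = cls (m i)"
    and indep: "\<And>A c i. finite A \<Longrightarrow> A \<subseteq> I \<Longrightarrow> (\<Sum>i\<in>A. scalar_series (c i) * m i) \<in> J \<Longrightarrow> i \<in> A \<Longrightarrow> c i = 0"
    and dense: "\<And>f n. f \<in> free_carrier X \<Longrightarrow> \<exists>A c. finite A \<and> A \<subseteq> I \<and>
      (\<exists>b\<in>free_carrier X. f - ((\<Sum>i\<in>A. scalar_series (c i) * m i) + fps_X ^ n * b) \<in> J)"
  shows "topological_basis_family H I e"
proof -
  have sum: "(\<Oplus>\<^bsub>H\<^esub> i\<in>A. c i \<odot>\<^bsub>H\<^esub> e i) = cls (\<Sum>i\<in>A. scalar_series (c i) * m i)"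
      and sumF: "(\<Sum>i\<in>A. scalar_series (c i) * m i) \<in> free_carrier X"
    if "finite A" "A \<subseteq> I" for A c
  proof -
    have I: "i \<in> I" if "i \<in> A" for i using \<open>A \<subseteq> I\<close> that by blast
    then show "(\<Sum>i\<in>A. scalar_series (c i) * m i) \<in> free_carrier X"
      using e by simp
    show "(\<Oplus>\<^bsub>H\<^esub> i\<in>A. c i \<odot>\<^bsub>H\<^esub> e i) = cls (\<Sum>i\<in>A. scalar_series (c i) * m i)"
      by (rule cls_finsum) (use I e that(1) in \<open>simp_all add: cls_smult\<close>)
  qed
  show ?thesis
    unfolding topological_basis_family_def lin_indep_family_def dense_span_def
  proof (intro conjI allI impI ballI)
    show "e ` I \<subseteq> carrier H" using e by (auto simp: carrier_H)
  next
    fix A c i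
    assume A: "finite A \<and> A \<subseteq> I \<and> (\<Oplus>\<^bsub>H\<^esub> i\<in>A. c i \<odot>\<^bsub>H\<^esub> e i) = \<zero>\<^bsub>H\<^esub>" and "i \<in> A"
    then have "cls (\<Sum>i\<in>A. scalar_series (c i) * m i) = cls 0"
      using A sum[of A c] cls_0 by metis
    then have "(\<Sum>i\<in>A. scalar_series (c i) * m i) \<in> J"
      using A sumF[of A c] cls_eq_iff[of "\<Sum>i\<in>A. scalar_series (c i) * m i" 0] by simp
    then show "c i = 0" using indep[of A c i] A \<open>i \<in> A\<close> by blast
  next
    fix x n assume "x \<in> carrier H"
    then obtain f where f: "f \<in> free_carrier X" "x = cls f" by (auto simp: carrier_H)
    then obtain A c b where A: "finite A" "A \<subseteq> I" "b \<in> free_carrier X"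
      "f - ((\<Sum>i\<in>A. scalar_series (c i) * m i) + fps_X ^ n * b) \<in> J"
      using dense[of f n] by blast
    let ?s = "\<Sum>i\<in>A. scalar_series (c i) * m i"
    have "x = cls (?s + fps_X ^ n * b)"
      using A f sumF[of A c] by (simp add: cls_eq_iff)
    also have "\<dots> = cls ?s \<oplus>\<^bsub>H\<^esub> cls (fps_X ^ n * b)"
      using A sumF[of A c] by (subst cls_add) auto
    also have "\<dots> = (\<Oplus>\<^bsub>H\<^esub> i\<in>A. c i \<odot>\<^bsub>H\<^esub> e i) \<oplus>\<^bsub>H\<^esub> fps_X ^ n \<odot>\<^bsub>H\<^esub> cls b"
      using A by (simp add: sum cls_smult scalar_series_fps_X_power)
    finally show "\<exists>A c. finite A \<and> A \<subseteq> I \<and>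
      (\<exists>z\<in>carrier H. x = (\<Oplus>\<^bsub>H\<^esub> i\<in>A. c i \<odot>\<^bsub>H\<^esub> e i) \<oplus>\<^bsub>H\<^esub> fps_X ^ n \<odot>\<^bsub>H\<^esub> z)"
      using A by (auto simp: carrier_H)
  qed
qed

end

section \<open>The generators with the hat\<close>

locale hat_basis =
  fixes N :: nat and \<nu> :: "nat \<Rightarrow> nat \<Rightarrow> complex"
  assumes N_ge_2: "2 \<le> N" and orthonormal: "orthonormal_basis_coeffs N \<nu>"
begin

text \<open>This is the value of the form on a_i and the k-th vector of the orthonormal basis, that
  is, the k-th coordinate of a_i. The form subtracts from a coefficient function its mean.\<close>

definition \<mu> :: "nat \<Rightarrow> nat \<Rightarrow> complex" where
  "\<mu> i k = hat_comb \<nu> k i - (\<Sum>j=1..N. hat_comb \<nu> k j) / of_nat N"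

lemma comb_form_hat_comb: "comb_form N x (hat_comb \<nu> k) = (\<Sum>i=1..N. x i * \<mu> i k)"
  unfolding comb_form_def
proof (rule sum.cong[OF refl])
  fix i assume i: "i \<in> {1..N}"
  have "(\<Sum>j=1..N. x i * hat_comb \<nu> k j * ((if i = j then 1 else 0) - 1 / of_nat N)) =
    (\<Sum>j=1..N. (if i = j then x i * hat_comb \<nu> k j else 0) - x i * (hat_comb \<nu> k j / of_nat N))"
    by (rule sum.cong) (auto simp: algebra_simps)
  also have "\<dots> = x i * \<mu> i k"
    using i by (simp add: sum_subtractf \<mu>_def sum.delta' right_diff_distrib
        sum_divide_distrib sum_distrib_left)
  finally show "(\<Sum>j=1..N. x i * hat_comb \<nu> k j * ((if i = j then 1 else 0) - 1 / of_nat N)) = x i * \<mu> i k" .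
qed

lemma sum_\<mu>: "(\<Sum>i=1..N. \<mu> i k) = 0"
  using N_ge_2 by (simp add: \<mu>_def sum_subtractf)

lemma sum_hat_comb_\<mu>:
  assumes "j \<in> {1..N-1}" "k \<in> {1..N-1}"
  shows "(\<Sum>i=1..N. hat_comb \<nu> j i * \<mu> i k) = (if j = k then 1 else 0)"
proof -
  have "comb_form N (hat_comb \<nu> j) (hat_comb \<nu> k) = (if j = k then 1 else 0)"
    using orthonormal assms unfolding orthonormal_basis_coeffs_def by blast
  then show ?thesis by (simp only: comb_form_hat_comb)
qed

lemma sum_\<nu>_\<mu>:
  assumes "j \<in> {1..N-1}" "k \<in> {1..N-1}"
  shows "(\<Sum>i=1..j. \<nu> i j * \<mu> i k) = (if j = k then 1 else 0)"
proof -
  have "(\<Sum>i=1..N. hat_comb \<nu> j i * \<mu> i k) = (\<Sum>i=1..j. \<nu> i j * \<mu> i k)"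
    by (rule sum.mono_neutral_cong_right) (use assms in \<open>auto simp: hat_comb_def\<close>)
  then show ?thesis using sum_hat_comb_\<mu>[OF assms] by simp
qed

text \<open>Since the basis spans, a_i has some coordinates; pairing with the l-th basis vector
  identifies them as \<open>\<mu> i l\<close>. The constant \<kappa> appears because a vector
  determines its coefficient function only up to a constant.\<close>

lemma sum_\<mu>_hat_comb:
  assumes "i \<in> {1..N}"
  shows "\<exists>\<kappa>. \<forall>i'\<in>{1..N}.
    (\<Sum>k=1..N-1. \<mu> i k * hat_comb \<nu> k i') = (if i' = i then 1 else 0) + \<kappa>"
proof -
  have "\<exists>c. is_zero_comb N (\<lambda>i'. (if i' = i then 1 else 0) - (\<Sum>k=1..N-1. c k * hat_comb \<nu> k i'))"
    by (rule orthonormal[unfolded orthonormal_basis_coeffs_def, THEN conjunct2, THEN conjunct1, THEN spec])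
  then obtain c d where c: "\<And>i'. i' \<in> {1..N} \<Longrightarrow>
      (if i' = i then 1 else 0) - (\<Sum>k=1..N-1. c k * hat_comb \<nu> k i') = d"
    unfolding is_zero_comb_def by blast
  have "c l = \<mu> i l" if l: "l \<in> {1..N-1}" for l
  proof -
    have "(\<Sum>i'=1..N. ((if i' = i then 1 else 0) - (\<Sum>k=1..N-1. c k * hat_comb \<nu> k i')) * \<mu> i' l) =
        (\<Sum>i'=1..N. d * \<mu> i' l)"
      by (rule sum.cong) (use c in auto)
    \<comment> \<open>The pairing kills the constant \<open>d\<close>, as a_1 + ... + a_N =
      0.\<close>
    also have "\<dots> = 0" by (simp only: sum_\<mu> mult_zero_right flip: sum_distrib_left)
    finally have "(\<Sum>i'=1..N. (if i' = i then 1 else 0) * \<mu> i' l) =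
        (\<Sum>i'=1..N. \<Sum>k=1..N-1. c k * hat_comb \<nu> k i' * \<mu> i' l)"
      by (simp add: left_diff_distrib sum_subtractf sum_distrib_right)
    also have "\<dots> = (\<Sum>k=1..N-1. c k * (\<Sum>i'=1..N. hat_comb \<nu> k i' * \<mu> i' l))"
      by (subst sum.swap) (simp add: sum_distrib_left mult.assoc)
    also have "\<dots> = (\<Sum>k=1..N-1. if k = l then c k else 0)"
      by (rule sum.cong) (use l in \<open>auto simp: sum_hat_comb_\<mu>[simplified]\<close>)
    also have "\<dots> = c l" using l by simp
    finally show ?thesis using assms by (simp add: if_distrib[of "\<lambda>x. x * _"] cong: if_cong)
  qed
  then have "(\<Sum>k=1..N-1. c k * hat_comb \<nu> k i') = (\<Sum>k=1..N-1. \<mu> i k * hat_comb \<nu> k i')" for i'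
    by (intro sum.cong) auto
  then show ?thesis using c by (intro exI[of _ "- d"]) (auto simp: algebra_simps)
qed

text \<open>Parseval's identity for <a_i, a_j>. The constant \<kappa> cancels because
  \<open>\<mu> j k\<close> subtracts the mean of the coefficient function.\<close>

lemma sum_\<mu>_\<mu>:
  assumes "i \<in> {1..N}" "j \<in> {1..N}"
  shows "(\<Sum>k=1..N-1. \<mu> i k * \<mu> j k) = (if i = j then 1 else 0) - 1 / of_nat N"
proof -
  obtain \<kappa> where \<kappa>: "\<And>i'. i' \<in> {1..N} \<Longrightarrow>
      (\<Sum>k=1..N-1. \<mu> i k * hat_comb \<nu> k i') = (if i' = i then 1 else 0) + \<kappa>"
    using sum_\<mu>_hat_comb[OF assms(1)] by blast
  have "(\<Sum>k=1..N-1. \<mu> i k * \<mu> j k) =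
     (\<Sum>k=1..N-1. \<mu> i k * hat_comb \<nu> k j) - (\<Sum>k=1..N-1. \<Sum>j'=1..N. \<mu> i k * hat_comb \<nu> k j') / of_nat N"
    by (simp add: \<mu>_def[of j] right_diff_distrib sum_subtractf sum_divide_distrib sum_distrib_left)
  also have "(\<Sum>k=1..N-1. \<Sum>j'=1..N. \<mu> i k * hat_comb \<nu> k j') =
      (\<Sum>j'=1..N. (if j' = i then 1 else 0) + \<kappa>)"
    by (subst sum.swap) (rule sum.cong[OF refl \<kappa>])
  also have "\<dots> = 1 + of_nat N * \<kappa>" using assms(1) by (simp add: sum.distrib)
  also have "(\<Sum>k=1..N-1. \<mu> i k * hat_comb \<nu> k j) - (1 + of_nat N * \<kappa>) / of_nat N =
      (if i = j then 1 else 0) - 1 / of_nat N"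
    using \<kappa>[OF assms(2)] N_ge_2 by (auto simp: add_divide_distrib)
  finally show ?thesis .
qed

end

text \<open>The coefficient of x^a y^b in the common factor of all s_ij, taken at x - y. The h^k
  term of this factor is a multiple of u^(-k-2), hence \<open>k + 2\<close>.\<close>

definition s_factor_coeff :: "nat \<Rightarrow> int \<Rightarrow> int \<Rightarrow> complex poly fps" where
  "s_factor_coeff N a b = Abs_fps (\<lambda>k. [:expand_coeff (k + 2) a b:] * s_factor N $ k)"

lemma subst_coeff_s_series:
  assumes "1 \<le> N" "i \<in> {1..N}" "j \<in> {1..N}"
  shows "subst_coeff (s_series N i j) a b =
    fps_const [:(if i = j then 1 else 0) - 1 / of_nat N:] * s_factor_coeff N a b"
proof (rule fps_ext)
  fix k
  define q where "q = [:(if i = j then 1 else 0) - 1 / of_nat N:] * s_factor N $ k"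
  have "(\<Sum>m\<le>degree (monom q (k + 2)). [:expand_coeff m a b:] * coeff (monom q (k + 2)) m) =
    [:expand_coeff (k + 2) a b:] * q"
  proof (cases "q = 0")
    case False
    have "(\<Sum>m\<le>k + 2. [:expand_coeff m a b:] * coeff (monom q (k + 2)) m) =
      (\<Sum>m\<le>k + 2. if k + 2 = m then [:expand_coeff m a b:] * q else 0)"
      by (rule sum.cong) auto
    then show ?thesis using False by (simp add: degree_monom_eq)
  qed simp
  then have "subst_coeff (s_series N i j) a b $ k = [:expand_coeff (k + 2) a b:] * q"
    by (simp only: subst_coeff_def s_series_nth[OF assms] q_def fps_nth_Abs_fps)
  then show "subst_coeff (s_series N i j) a b $ k =
    (fps_const [:(if i = j then 1 else 0) - 1 / of_nat N:] * s_factor_coeff N a b) $ k"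
    by (simp only: q_def s_factor_coeff_def fps_mult_left_const_nth fps_nth_Abs_fps mult.left_commute)
qed

text \<open>The structure constant read off from the quadratic relation: the commutator of y_i^(r)
  and y_j^(s) is <a_i, a_j> times it. The exponents in \<open>expand_coeff (k + 2)\<close> add up to
  -k-2, so only the power h^(r+s) occurs.\<close>

definition \<gamma> :: "nat \<Rightarrow> int \<Rightarrow> int \<Rightarrow> complex poly fps" where
  "\<gamma> N r s = s_factor_coeff N (- s - 1) (- r - 1) - s_factor_coeff N (- r - 1) (- s - 1)"

lemma \<gamma>_swap: "\<gamma> N s r = - \<gamma> N r s"
  by (simp add: \<gamma>_def)

text \<open>In the expansions x has exponent at most -2 and y a nonnegative one, so -1 occurs for
  neither variable. This makes the missing y_i^(0) compatible with the relators in which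
  \<open>r\<close> or \<open>s\<close> is 0.\<close>

lemma \<gamma>_0: "r = 0 \<or> s = 0 \<Longrightarrow> \<gamma> N r s = 0"
  by (auto simp: \<gamma>_def s_factor_coeff_def expand_coeff_def fps_eq_iff)

section \<open>Density\<close>

lemma central_series_in_free_carrier: "central_series p \<in> free_carrier (H_gens N)"
  unfolding mem_free_carrier central_series_def
  by (auto intro!: letters_in_sum letters_in_single simp: H_gens_def)

lemma H_rels_subset: "H_rels N \<subseteq> free_carrier (H_gens N)"
proof -
  have y: "y_coeff i r \<in> free_carrier (H_gens N)" if "Suc 0 \<le> i" "i \<le> N" for i r
    using that by (auto simp: y_coeff_def H_gens_def)
  have "GC \<in> H_gens N" by (simp add: H_gens_def)
  then show ?thesis
    by (auto simp: H_rels_def yy_relator_def y central_series_in_free_carrier intro!: free_carrier_sum)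
qed

context hat_basis
begin

sublocale presentation "H_gens N" "H_rels N"
  by standard (rule H_rels_subset)

lemma H_algebra_eq: "H_algebra N = H"
  by (simp add: H_algebra_def)

text \<open>Representatives in the completed free algebra; \<open>hat_gen_eq\<close> and
  \<open>monomial_eq\<close> link them to the quotient.\<close>

fun hat_series :: "gen \<Rightarrow> gen free_series" where
  "hat_series GC = gen_series GC"
| "hat_series (GY j r) = (\<Sum>i=1..j. scalar_series (fps_const (\<nu> i j)) * gen_series (GY i r))"

definition word_series :: "gen list \<Rightarrow> gen free_series" where
  "word_series ms = prod_list (map hat_series ms)"

lemma word_series_simps [simp]:
  "word_series [] = 1"
  "word_series (m # ms) = hat_series m * word_series ms"
  by (simp_all add: word_series_def)

lemma GY_in_H_gens: "GY i r \<in> H_gens N \<longleftrightarrow> i \<in> {1..N} \<and> r \<noteq> 0"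
  by (auto simp: H_gens_def)

lemma GC_in_H_gens: "GC \<in> H_gens N"
  by (simp add: H_gens_def)

lemma GY_in_hat_gens: "GY i r \<in> hat_gens N \<longleftrightarrow> i \<in> {1..N-1} \<and> r \<noteq> 0"
  by (auto simp: hat_gens_def)

lemma hat_series_in_carrier: "m \<in> hat_gens N \<Longrightarrow> hat_series m \<in> free_carrier (H_gens N)"
  by (cases m) (auto simp: GC_in_H_gens GY_in_hat_gens GY_in_H_gens
    intro!: free_carrier_sum free_carrier_mult free_carrier_gen_series)

lemma word_series_in_carrier: "set ms \<subseteq> hat_gens N \<Longrightarrow> word_series ms \<in> free_carrier (H_gens N)"
  by (induction ms) (auto simp: hat_series_in_carrier)

lemma hat_gen_eq: "m \<in> hat_gens N \<Longrightarrow> hat_gen N \<nu> m = cls (hat_series m)"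
proof (cases m)
  case GC
  then show ?thesis by (simp add: H_gen_def presented_gen_def cls_def)
next
  case (GY j r)
  assume "m \<in> hat_gens N"
  then have "i \<in> {1..j} \<Longrightarrow> gen_series (GY i r) \<in> free_carrier (H_gens N)" for i
    using GY by (auto simp: GY_in_hat_gens GY_in_H_gens intro!: free_carrier_gen_series)
  then have "(\<Oplus>\<^bsub>H\<^esub> i\<in>{1..j}. fps_const (\<nu> i j) \<odot>\<^bsub>H\<^esub> H_gen N (GY i r)) =
      cls (\<Sum>i=1..j. scalar_series (fps_const (\<nu> i j)) * gen_series (GY i r))"
    by (intro cls_finsum) (auto simp: H_gen_def presented_gen_def cls_smult simp flip: cls_def)
  then show ?thesis using GY by (simp add: H_algebra_eq)
qed

lemma monomial_eq: "set ms \<subseteq> hat_gens N \<Longrightarrow> monomial N \<nu> ms = cls (word_series ms)"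
  by (induction ms)
    (simp_all add: monomial_def H_algebra_eq cls_1 hat_gen_eq cls_mult hat_series_in_carrier
      word_series_in_carrier)

abbreviation cong_J :: "gen free_series \<Rightarrow> gen free_series \<Rightarrow> bool" (infix "\<approx>" 50) where
  "f \<approx> g \<equiv> f - g \<in> J"

lemma GC_gen_commute: "g \<in> H_gens N \<Longrightarrow> gen_series GC * gen_series g \<approx> gen_series g * gen_series GC"
  by (rule rels_in_J) (auto simp: H_rels_def)

lemma yy_relator_in_J: "i \<in> {1..N} \<Longrightarrow> j \<in> {1..N} \<Longrightarrow> yy_relator N i j r s \<in> J"
  by (rule rels_in_J) (unfold H_rels_def, blast)

lemma GC_hat_commute:
  assumes "m \<in> hat_gens N"
  shows "gen_series GC * hat_series m \<approx> hat_series m * gen_series GC"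
proof (cases m)
  case GC
  then show ?thesis by (simp add: J_0)
next
  case (GY j r)
  have "gen_series GC * hat_series m - hat_series m * gen_series GC =
    (\<Sum>i=1..j. scalar_series (fps_const (\<nu> i j)) *
      (gen_series GC * gen_series (GY i r) - gen_series (GY i r) * gen_series GC))"
    by (simp add: GY sum_distrib_left sum_distrib_right right_diff_distrib sum_subtractf
        mult.assoc[symmetric] scalar_series_commute[symmetric, of "gen_series GC"])
  also have "\<dots> \<in> J"
    using assms GY
    by (intro J_sum J_mult_left GC_gen_commute) (auto simp: GY_in_hat_gens GY_in_H_gens)
  finally show ?thesis .
qed

section \<open>Spans of increasing words modulo powers of h\<close>

definition ideal_mod :: "nat \<Rightarrow> gen free_series set" where
  "ideal_mod n = {a + fps_X ^ n * b | a b. a \<in> J \<and> b \<in> free_carrier (H_gens N)}"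

lemma ideal_modI: "a \<in> J \<Longrightarrow> b \<in> free_carrier (H_gens N) \<Longrightarrow> a + fps_X ^ n * b \<in> ideal_mod n"
  by (auto simp: ideal_mod_def)

lemma J_subset_ideal_mod: "a \<in> J \<Longrightarrow> a \<in> ideal_mod n"
  using ideal_modI[of a 0 n] by simp

lemma fps_X_power_in_ideal_mod: "b \<in> free_carrier (H_gens N) \<Longrightarrow> fps_X ^ n * b \<in> ideal_mod n"
  using ideal_modI[of 0 b n] J_0 by simp

lemma ideal_mod_add: assumes "f \<in> ideal_mod n" "g \<in> ideal_mod n" shows "f + g \<in> ideal_mod n"
proof -
  obtain a b a' b' where *: "a \<in> J" "a' \<in> J" "b \<in> free_carrier (H_gens N)" "b' \<in> free_carrier (H_gens N)"
    and "f = a + fps_X ^ n * b" "g = a' + fps_X ^ n * b'"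
    using assms by (auto simp: ideal_mod_def)
  then have "f + g = (a + a') + fps_X ^ n * (b + b')" by (simp add: distrib_left)
  then show ?thesis using ideal_modI[of "a + a'" "b + b'" n] * J_add by simp
qed

lemma ideal_mod_mult_left:
  assumes "f \<in> free_carrier (H_gens N)" "g \<in> ideal_mod n"
  shows "f * g \<in> ideal_mod n"
proof -
  obtain a b where *: "a \<in> J" "b \<in> free_carrier (H_gens N)" and "g = a + fps_X ^ n * b"
    using assms by (auto simp: ideal_mod_def)
  then have "f * g = f * a + fps_X ^ n * (f * b)"
    using fps_mult_fps_X_power_commute[of n f] by (simp add: distrib_left mult.assoc[symmetric])
  then show ?thesis using ideal_modI[of "f * a" "f * b" n] * assms J_mult_left by simp
qed

lemma ideal_mod_in_carrier: "f \<in> ideal_mod n \<Longrightarrow> f \<in> free_carrier (H_gens N)"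
  by (auto simp: ideal_mod_def dest: J_subset_carrier)

text \<open>Adding one term at a time avoids the bookkeeping of supports and coefficient families,
  which \<open>word_span_expansion\<close> restores at the end. The set \<open>B\<close> records the
  letters that may occur; without it one could not tell whether a letter may be put in front of all
  the words.\<close>

inductive_set word_span :: "nat \<Rightarrow> gen set \<Rightarrow> gen free_series set" for n B where
  base: "f \<in> ideal_mod n \<Longrightarrow> f \<in> word_span n B"
| step: "f \<in> word_span n B \<Longrightarrow> w \<in> increasing_words N \<Longrightarrow> set w \<subseteq> B \<Longrightarrow>
    f + scalar_series c * word_series w \<in> word_span n B"

lemma word_span_in_carrier: "f \<in> word_span n B \<Longrightarrow> f \<in> free_carrier (H_gens N)"
  by (induction rule: word_span.induct)
    (auto simp: ideal_mod_in_carrier increasing_words_def word_series_in_carrier)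

lemma word_span_0: "0 \<in> word_span n B"
  by (rule base) (simp add: J_subset_ideal_mod J_0)

lemma word_span_J: "f \<in> J \<Longrightarrow> f \<in> word_span n B"
  by (rule base) (rule J_subset_ideal_mod)

lemma word_span_word: "w \<in> increasing_words N \<Longrightarrow> set w \<subseteq> B \<Longrightarrow> word_series w \<in> word_span n B"
  using step[OF word_span_0, where c = 1 and w = w] by simp

lemma word_span_add: "f \<in> word_span n B \<Longrightarrow> g \<in> word_span n B \<Longrightarrow> f + g \<in> word_span n B"
proof (induction rule: word_span.induct)
  case (base f)
  from base(2,1) show ?case
    by (induction rule: word_span.induct)
      (auto simp: add.assoc[symmetric] intro: word_span.intros ideal_mod_add)
next
  case (step f w c)
  then have "(f + g) + scalar_series c * word_series w \<in> word_span n B" by (intro word_span.step)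
  then show ?case by (simp add: algebra_simps)
qed

lemma word_span_sum: "(\<And>i. i \<in> A \<Longrightarrow> f i \<in> word_span n B) \<Longrightarrow> sum f A \<in> word_span n B"
  by (induction A rule: infinite_finite_induct) (auto intro: word_span_add word_span_0)

lemma word_span_scalar: "f \<in> word_span n B \<Longrightarrow> scalar_series d * f \<in> word_span n B"
proof (induction rule: word_span.induct)
  case (base f)
  then show ?case by (intro word_span.base ideal_mod_mult_left) simp_all
next
  case (step f w c)
  then have "scalar_series d * f + scalar_series (d * c) * word_series w \<in> word_span n B"
    by (intro word_span.step)
  then show ?case by (simp add: distrib_left scalar_series_mult mult.assoc)
qed

lemma word_span_mono: "f \<in> word_span n B \<Longrightarrow> B \<subseteq> B' \<Longrightarrow> f \<in> word_span n B'"
  by (induction rule: word_span.induct) (auto intro: word_span.intros)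

lemma word_span_cong: "f \<approx> g \<Longrightarrow> g \<in> word_span n B \<Longrightarrow> f \<in> word_span n B"
  using word_span_add[of g n B "f - g"] word_span_J by simp

lemma word_span_mult_left:
  assumes "f \<in> word_span n B" "t \<in> free_carrier (H_gens N)"
    and "\<And>w. w \<in> increasing_words N \<Longrightarrow> set w \<subseteq> B \<Longrightarrow> t * word_series w \<in> word_span n B'"
  shows "t * f \<in> word_span n B'"
  using assms(1)
proof (induction rule: word_span.induct)
  case (base f)
  then show ?case using assms(2) by (intro word_span.base ideal_mod_mult_left)
next
  case (step f w c)
  have "t * (scalar_series c * word_series w) = scalar_series c * (t * word_series w)"
    by (simp add: scalar_series_commute[symmetric, of t] flip: mult.assoc)
  then show ?case
    using word_span_add[OF step.IH word_span_scalar[OF assms(3)[OF step.hyps(2,3)], of c]]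
    by (simp add: distrib_left)
qed

text \<open>C is the least letter, so it may be put in front of every increasing word.\<close>

lemma word_span_GC_mult:
  assumes "f \<in> word_span n B" "GC \<in> B"
  shows "gen_series GC * f \<in> word_span n B"
proof (rule word_span_mult_left[OF assms(1)])
  fix w assume w: "w \<in> increasing_words N" "set w \<subseteq> B"
  have "gen_less GC m \<or> GC = m" for m by (cases m) auto
  then have "GC # w \<in> increasing_words N"
    using w by (auto simp: increasing_words_def hat_gens_def)
  then show "gen_series GC * word_series w \<in> word_span n B"
    using word_span_word[of "GC # w" B n] w assms(2) by simp
qed (simp add: GC_in_H_gens)

text \<open>Modulo h^n a series is a polynomial in h whose coefficients are finite combinations of
  words in \<open>Y\<close>, so stability under single generators suffices. It is applied to central
  series with \<open>Y = {GC}\<close>, and to the whole algebra with all generators.\<close>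

lemma word_span_series_mult:
  assumes g: "\<And>g x. g \<in> Y \<Longrightarrow> x \<in> word_span n B \<Longrightarrow> gen_series g * x \<in> word_span n B"
    and Y: "Y \<subseteq> H_gens N" and f: "f \<in> free_carrier Y" and x: "x \<in> word_span n B"
  shows "f * x \<in> word_span n B"
proof -
  have prod: "prod_list (map gen_series gs) * x \<in> word_span n B" if "set gs \<subseteq> Y" for gs
    using that by (induction gs) (auto simp: x g mult.assoc)
  have coeff: "fps_const (f $ k) * x \<in> word_span n B" for k
  proof -
    have "fps_const (f $ k) * x = (\<Sum>w\<in>Poly_Mapping.keys (f $ k).
        fps_const (Poly_Mapping.single w (Poly_Mapping.lookup (f $ k) w)) * x)"
      by (subst single_expansion[of "f $ k"]) (simp only: fps_const_sum sum_distrib_right)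
    also have "\<dots> \<in> word_span n B"
    proof (rule word_span_sum)
      fix w assume w: "w \<in> Poly_Mapping.keys (f $ k)"
      obtain gs where gs: "w = FWord gs" by (cases w)
      then have "set gs \<subseteq> Y" using f w unfolding mem_free_carrier letters_in_def by (metis fword.sel)
      then show "fps_const (Poly_Mapping.single w (Poly_Mapping.lookup (f $ k) w)) * x \<in> word_span n B"
        by (simp add: gs fps_const_single mult.assoc word_span_scalar prod)
    qed
    finally show ?thesis .
  qed
  have "(fps_X ^ k * fps_const (f $ k)) $ m = (if m = k then f $ k else 0)" for k m
    by (auto simp: fps_X_power_mult_nth)
  \<comment> \<open>The tail is divisible by h^n and disappears in
    \<open>ideal_mod n\<close>.\<close>
  then have fin: "f = (\<Sum>k<n. fps_X ^ k * fps_const (f $ k)) + fps_X ^ n * fps_shift n f"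
    by (intro fps_ext) (auto simp: fps_sum_nth fps_X_power_mult_nth)
  have "f * x = (\<Sum>k<n. fps_X ^ k * (fps_const (f $ k) * x)) + fps_X ^ n * (fps_shift n f * x)"
    by (subst fin) (simp only: distrib_right sum_distrib_right mult.assoc)
  moreover have "fps_X ^ k * (fps_const (f $ k) * x) \<in> word_span n B" for k
    using word_span_scalar[OF coeff, of "fps_X ^ k" k] by (simp add: scalar_series_fps_X_power)
  moreover have "fps_X ^ n * (fps_shift n f * x) \<in> word_span n B"
  proof (intro base fps_X_power_in_ideal_mod free_carrier_mult)
    show "x \<in> free_carrier (H_gens N)" using x by (rule word_span_in_carrier)
    show "fps_shift n f \<in> free_carrier (H_gens N)"
      using f Y by (fastforce simp: mem_free_carrier letters_in_def)
  qed
  ultimately show ?thesis by (auto intro!: word_span_add word_span_sum)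
qed

lemma word_span_central_series_mult:
  assumes "x \<in> word_span n B" "GC \<in> B"
  shows "central_series p * x \<in> word_span n B"
proof (rule word_span_series_mult[OF _ _ _ assms(1)])
  show "{GC} \<subseteq> H_gens N" by (simp add: GC_in_H_gens)
  show "central_series p \<in> free_carrier {GC}"
    unfolding mem_free_carrier central_series_def
    by (auto intro!: letters_in_sum letters_in_single)
qed (auto simp: word_span_GC_mult assms)

section \<open>The order on letters and the insertion of a letter\<close>

lemma gen_less_trans: "gen_less a b \<Longrightarrow> gen_less b c \<Longrightarrow> gen_less a c"
  by (cases a; cases b; cases c) auto

lemma gen_less_total: "gen_less a b \<or> a = b \<or> gen_less b a"
  by (cases a; cases b) auto

lemma gen_less_antisym: "gen_less a b \<Longrightarrow> \<not> gen_less b a"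
  by (cases a; cases b) auto

fun ins :: "gen \<Rightarrow> gen list \<Rightarrow> gen list" where
  "ins a [] = [a]"
| "ins a (b # w) = (if gen_less b a then b # ins a w else a # b # w)"

lemma set_ins: "set (ins a w) = insert a (set w)"
  by (induction w) auto

lemma increasing_words_Cons:
  "a # w \<in> increasing_words N \<longleftrightarrow>
    a \<in> hat_gens N \<and> (\<forall>b\<in>set w. gen_less a b \<or> a = b) \<and> w \<in> increasing_words N"
  by (auto simp: increasing_words_def)

lemma ins_increasing:
  "w \<in> increasing_words N \<Longrightarrow> a \<in> hat_gens N \<Longrightarrow> ins a w \<in> increasing_words N"
proof (induction w)
  case Nil
  then show ?case by (simp add: increasing_words_def)
next
  case (Cons b w)
  show ?case
  proof (cases "gen_less b a")
    case True
    then show ?thesis using Cons by (auto simp: increasing_words_Cons set_ins)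
  next
    case False
    then have "gen_less a b \<or> a = b" using gen_less_total by blast
    then show ?thesis using False Cons.prems
      by (auto simp: increasing_words_Cons intro: gen_less_trans)
  qed
qed

text \<open>The letter \<open>b\<close> has to pass only the letters C at the front of a word, with
  which it commutes modulo \<open>J\<close>; after that it stands at its place.\<close>

lemma word_span_smallest_mult:
  assumes b: "b \<in> hat_gens N" and GC: "GC \<in> B"
    and B: "\<And>c. c \<in> B \<Longrightarrow> gen_less b c \<or> b = c \<or> c = GC"
    and f: "f \<in> word_span n B"
  shows "hat_series b * f \<in> word_span n (insert b B)"
proof (rule word_span_mult_left[OF f hat_series_in_carrier[OF b]])
  fix w assume "w \<in> increasing_words N" "set w \<subseteq> B"
  then show "hat_series b * word_series w \<in> word_span n (insert b B)"
  proof (induction w)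
    case Nil
    then show ?case
      using b word_span_word[of "[b]" "insert b B" n] by (simp add: increasing_words_def)
  next
    case (Cons c w)
    show ?case
    proof (cases "gen_less b c \<or> b = c")
      case True
      then have "b # c # w \<in> increasing_words N"
        using b Cons.prems by (auto simp: increasing_words_Cons intro: gen_less_trans)
      then show ?thesis
        using word_span_word[of "b # c # w" "insert b B" n] Cons.prems by auto
    next
      case False
      then have c: "c = GC" using B Cons.prems by auto
      have w: "w \<in> increasing_words N" "set w \<subseteq> B"
        using Cons.prems by (auto simp: increasing_words_Cons)
      have "hat_series b * word_series (c # w) - gen_series GC * (hat_series b * word_series w) =
          - ((gen_series GC * hat_series b - hat_series b * gen_series GC) * word_series w)"
        by (simp add: c algebra_simps)
      also have "\<dots> \<in> J"
        using w by (intro J_uminus J_mult_right GC_hat_commute[OF b] word_series_in_carrier)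
          (auto simp: increasing_words_def)
      finally show ?thesis
        using Cons.IH[OF w] GC by (blast intro: word_span_cong word_span_GC_mult)
    qed
  qed
qed

text \<open>The property of a commutator on which reordering relies: it preserves every span that
  admits the letter C.\<close>

definition span_multiplier :: "gen free_series \<Rightarrow> bool" where
  "span_multiplier z \<longleftrightarrow> (\<forall>n B x. GC \<in> B \<longrightarrow> x \<in> word_span n B \<longrightarrow> z * x \<in> word_span n B)"

text \<open>Both factors are linear combinations of the y_i, so their commutator is a bilinear
  combination of quadratic relators up to the same combination \<open>Z\<close> of the central
  terms. These are series in C and therefore preserve spans.\<close>

lemma hat_commutator:
  assumes "GY k r \<in> hat_gens N" "GY l s \<in> hat_gens N"
  shows "\<exists>z. span_multiplier z \<and>
    hat_series (GY k r) * hat_series (GY l s) - hat_series (GY l s) * hat_series (GY k r) - z \<in> J"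
proof -
  let ?sc = "\<lambda>c. scalar_series (fps_const c) :: gen free_series"
  define z where "z i j =
    central_series (subst_coeff (s_series N i j) (- s - 1) (- r - 1))
     - central_series (subst_coeff (s_series N i j) (- r - 1) (- s - 1))" for i j
  define Z where "Z = (\<Sum>i=1..k. \<Sum>j=1..l. ?sc (\<nu> i k) * (?sc (\<nu> j l) * z i j))"
  have rs: "r \<noteq> 0" "s \<noteq> 0" using assms by (auto simp: GY_in_hat_gens)
  have "span_multiplier Z"
    unfolding span_multiplier_def
  proof (intro allI impI)
    fix n B x assume B: "GC \<in> B" and x: "x \<in> word_span n B"
    have "z i j * x \<in> word_span n B" for i j
    proof -
      have "z i j * x = central_series (subst_coeff (s_series N i j) (- s - 1) (- r - 1)) * x
        + scalar_series (- 1) * (central_series (subst_coeff (s_series N i j) (- r - 1) (- s - 1)) * x)"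
        by (simp add: z_def left_diff_distrib scalar_series_uminus)
      then show ?thesis
        using x B by (auto intro!: word_span_add word_span_scalar word_span_central_series_mult)
    qed
    then show "Z * x \<in> word_span n B"
      by (auto simp: Z_def sum_distrib_right mult.assoc intro!: word_span_sum word_span_scalar)
  qed
  moreover have "hat_series (GY k r) * hat_series (GY l s) - hat_series (GY l s) * hat_series (GY k r) - Z =
    (\<Sum>i=1..k. \<Sum>j=1..l. ?sc (\<nu> i k) * (?sc (\<nu> j l) * yy_relator N i j r s))"
  proof -
    have sc: "x * (?sc b * y) = ?sc b * (x * y)" for b x y
      by (simp add: scalar_series_commute[symmetric, of x] flip: mult.assoc)
    have comm: "?sc a * x * (?sc b * y) = ?sc a * (?sc b * (x * y))"
      "?sc b * y * (?sc a * x) = ?sc a * (?sc b * (y * x))" for a b x y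
      using sc[of x b y] sc[of "?sc b * y" a x] by (simp_all add: mult.assoc)
    have 1: "hat_series (GY k r) * hat_series (GY l s) =
      (\<Sum>i=1..k. \<Sum>j=1..l. ?sc (\<nu> i k) * (?sc (\<nu> j l) * (y_coeff i r * y_coeff j s)))"
      using rs by (simp add: sum_product comm(1) y_coeff_def)
    have 2: "hat_series (GY l s) * hat_series (GY k r) =
      (\<Sum>i=1..k. \<Sum>j=1..l. ?sc (\<nu> i k) * (?sc (\<nu> j l) * (y_coeff j s * y_coeff i r)))"
      using rs by (subst sum.swap) (simp add: sum_product comm(2) y_coeff_def)
    show ?thesis
      unfolding 1 2 Z_def z_def yy_relator_def sum_subtractf[symmetric] right_diff_distrib[symmetric]
      by (simp add: algebra_simps)
  qed
  moreover have "(\<Sum>i=1..k. \<Sum>j=1..l. ?sc (\<nu> i k) * (?sc (\<nu> j l) * yy_relator N i j r s)) \<in> J"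
    using assms
    by (intro J_sum J_mult_left yy_relator_in_J free_carrier_scalar_series)
      (auto simp: GY_in_hat_gens)
  ultimately show ?thesis by (intro exI[of _ Z]) simp
qed

text \<open>If the head b is smaller than a, then a b w = b a w + z w modulo \<open>J\<close>, and
  the induction hypothesis treats a w. Its remainder must then be multiplied by b, and b can be put
  in front again because the remainder has only letters of w, which are not smaller than b, and C.
  This is why the letters are controlled in the statement.\<close>

lemma word_series_ins:
  assumes "w \<in> increasing_words N" "a \<in> hat_gens N"
  shows "hat_series a * word_series w - word_series (ins a w) \<in> word_span n (insert GC (set w))"
  using assms(1)
proof (induction w)
  case Nil
  then show ?case by (simp add: word_span_0)
next
  case (Cons b w)
  then have w: "w \<in> increasing_words N" and b: "b \<in> hat_gens N"
    and bw: "\<And>c. c \<in> set w \<Longrightarrow> gen_less b c \<or> b = c"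
    by (auto simp: increasing_words_Cons)
  show ?case
  proof (cases "gen_less b a")
    case True
    have "\<exists>z. span_multiplier z \<and> hat_series a * hat_series b - hat_series b * hat_series a - z \<in> J"
    proof (cases b)
      case GC
      then show ?thesis
        using J_uminus[OF GC_hat_commute[OF assms(2)]]
        by (intro exI[of _ 0]) (simp add: span_multiplier_def word_span_0)
    next
      case (GY l s)
      then show ?thesis using hat_commutator True b assms(2) by (cases a) auto
    qed
    then obtain z where z: "span_multiplier z"
      "hat_series a * hat_series b - hat_series b * hat_series a - z \<in> J" by blast
    have W: "word_series w \<in> free_carrier (H_gens N)"
      using w by (auto simp: increasing_words_def word_series_in_carrier)
    let ?B = "insert GC (set (b # w))"
    have "(hat_series a * hat_series b - hat_series b * hat_series a - z) * word_series w \<in> word_span n ?B"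
      by (intro word_span_J J_mult_right z W)
    moreover have "word_series w \<in> word_span n ?B" by (rule word_span_word[OF w]) auto
    then have "z * word_series w \<in> word_span n ?B"
      using z(1) unfolding span_multiplier_def by simp
    moreover have "hat_series b * (hat_series a * word_series w - word_series (ins a w)) \<in> word_span n ?B"
      using word_span_smallest_mult[OF b _ _ Cons.IH[OF w]] bw by (auto simp: insert_commute)
    ultimately have "(hat_series a * hat_series b - hat_series b * hat_series a - z) * word_series w
        + z * word_series w + hat_series b * (hat_series a * word_series w - word_series (ins a w))
        \<in> word_span n ?B"
      by (intro word_span_add)
    then show ?thesis using True by (simp add: algebra_simps)
  next
    case False
    then show ?thesis by (simp add: word_span_0)
  qed
qed

section \<open>Increasing words span modulo every power of h\<close>

lemma word_span_hat_mult:
  assumes "a \<in> hat_gens N" "f \<in> word_span n (hat_gens N)"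
  shows "hat_series a * f \<in> word_span n (hat_gens N)"
proof (rule word_span_mult_left[OF assms(2) hat_series_in_carrier[OF assms(1)]])
  fix w assume w: "w \<in> increasing_words N" "set w \<subseteq> hat_gens N"
  have "hat_series a * word_series w - word_series (ins a w) \<in> word_span n (hat_gens N)"
    using word_series_ins[OF w(1) assms(1)] by (rule word_span_mono) (use w in \<open>simp add: hat_gens_def\<close>)
  moreover have "word_series (ins a w) \<in> word_span n (hat_gens N)"
    using w assms by (intro word_span_word ins_increasing) (auto simp: set_ins)
  ultimately show "hat_series a * word_series w \<in> word_span n (hat_gens N)"
    using word_span_add by fastforce
qed

text \<open>The coordinates \<open>\<mu> i k\<close> recover the coefficient function of a_i up to a
  constant \<kappa>, and \<kappa> times the sum of all y_i^(r) is a multiple of a linear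
  relator.\<close>

lemma gen_series_GY_cong:
  assumes "GY i r \<in> H_gens N"
  shows "(\<Sum>k=1..N-1. scalar_series (fps_const (\<mu> i k)) * hat_series (GY k r)) \<approx> gen_series (GY i r)"
proof -
  let ?sc = "\<lambda>c. scalar_series (fps_const c) :: gen free_series"
  have i: "i \<in> {1..N}" and r: "r \<noteq> 0" using assms by (auto simp: GY_in_H_gens)
  obtain \<kappa> where \<kappa>: "\<And>i'. i' \<in> {1..N} \<Longrightarrow>
      (\<Sum>k=1..N-1. \<mu> i k * hat_comb \<nu> k i') = (if i' = i then 1 else 0) + \<kappa>"
    using sum_\<mu>_hat_comb[OF i] by blast
  have hat: "hat_series (GY k r) = (\<Sum>i'=1..N. ?sc (hat_comb \<nu> k i') * gen_series (GY i' r))"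
    if "k \<in> {1..N-1}" for k
    unfolding hat_series.simps
    by (rule sum.mono_neutral_cong_left) (use that in \<open>auto simp: hat_comb_def\<close>)
  have "(\<Sum>k=1..N-1. ?sc (\<mu> i k) * hat_series (GY k r)) =
      (\<Sum>k=1..N-1. \<Sum>i'=1..N. ?sc (\<mu> i k * hat_comb \<nu> k i') * gen_series (GY i' r))"
    by (rule sum.cong[OF refl])
      (simp only: hat sum_distrib_left fps_const_mult[symmetric] scalar_series_mult mult.assoc)
  also have "\<dots> = (\<Sum>i'=1..N. ?sc (\<Sum>k=1..N-1. \<mu> i k * hat_comb \<nu> k i') * gen_series (GY i' r))"
    by (subst sum.swap) (simp only: fps_const_sum scalar_series_sum sum_distrib_right)
  also have "\<dots> = (\<Sum>i'=1..N. (if i' = i then gen_series (GY i' r) else 0) + ?sc \<kappa> * y_coeff i' r)"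
    by (rule sum.cong[OF refl])
      (use r in \<open>auto simp: \<kappa>[simplified] y_coeff_def scalar_series_add distrib_right simp flip: fps_const_add\<close>)
  also have "\<dots> = gen_series (GY i r) + ?sc \<kappa> * (\<Sum>i'=1..N. y_coeff i' r)"
    using i by (simp add: sum.distrib sum_distrib_left)
  finally have "(\<Sum>k=1..N-1. ?sc (\<mu> i k) * hat_series (GY k r)) - gen_series (GY i r) =
      ?sc \<kappa> * (\<Sum>i'=1..N. y_coeff i' r)" by simp
  also have "\<dots> \<in> J"
    by (intro J_mult_left rels_in_J) (auto simp: H_rels_def)
  finally show ?thesis .
qed

lemma word_span_gen_mult:
  assumes "g \<in> H_gens N" "x \<in> word_span n (hat_gens N)"
  shows "gen_series g * x \<in> word_span n (hat_gens N)"
proof (cases g)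
  case GC
  then show ?thesis using assms word_span_hat_mult[of GC] by (auto simp: hat_gens_def)
next
  case (GY i r)
  let ?y = "\<Sum>k=1..N-1. scalar_series (fps_const (\<mu> i k)) * hat_series (GY k r)"
  have "?y * x \<in> word_span n (hat_gens N)"
    using assms GY
    by (auto simp: sum_distrib_right mult.assoc GY_in_H_gens GY_in_hat_gens simp del: hat_series.simps
      intro!: word_span_sum word_span_scalar word_span_hat_mult)
  moreover have "- ((?y - gen_series g) * x) \<in> J"
    using assms GY by (intro J_uminus J_mult_right)
      (auto intro: gen_series_GY_cong[simplified] word_span_in_carrier)
  then have "gen_series g * x \<approx> ?y * x" by (simp add: left_diff_distrib)
  ultimately show ?thesis by (rule word_span_cong[rotated])
qed

lemma free_carrier_subset_word_span:
  assumes "f \<in> free_carrier (H_gens N)"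
  shows "f \<in> word_span n (hat_gens N)"
proof -
  have "1 \<in> word_span n (hat_gens N)"
    using word_span_word[of "[]" "hat_gens N" n] by (simp add: increasing_words_def)
  then show ?thesis
    using word_span_series_mult[OF word_span_gen_mult order_refl assms, where x = 1 and n = n] by simp
qed

lemma word_span_expansion:
  assumes "f \<in> word_span n B"
  shows "\<exists>A c. finite A \<and> A \<subseteq> increasing_words N \<and>
    f - (\<Sum>w\<in>A. scalar_series (c w) * word_series w) \<in> ideal_mod n"
  using assms
proof (induction rule: word_span.induct)
  case (base f)
  then show ?case by (intro exI[of _ "{}"]) auto
next
  case (step f w d)
  then obtain A c where A: "finite A" "A \<subseteq> increasing_words N"
    "f - (\<Sum>w\<in>A. scalar_series (c w) * word_series w) \<in> ideal_mod n" by blast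
  \<comment> \<open>The word \<open>w\<close> may already lie in \<open>A\<close>; then
    \<open>d\<close> is added to its coefficient.\<close>
  define c' where "c' v = (if v \<in> A then c v else 0) + (if v = w then d else 0)" for v
  have "(\<Sum>v\<in>insert w A. scalar_series (c' v) * word_series v) =
    (\<Sum>v\<in>insert w A. if v \<in> A then scalar_series (c v) * word_series v else 0) +
    (\<Sum>v\<in>insert w A. if v = w then scalar_series d * word_series v else 0)"
    unfolding sum.distrib[symmetric]
    by (rule sum.cong) (auto simp: c'_def scalar_series_add distrib_right)
  also have "(\<Sum>v\<in>insert w A. if v \<in> A then scalar_series (c v) * word_series v else 0) =
      (\<Sum>v\<in>A. scalar_series (c v) * word_series v)"
    by (rule sum.mono_neutral_cong_right) (use A in auto)
  finally have "f + scalar_series d * word_series w - (\<Sum>v\<in>insert w A. scalar_series (c' v) * word_series v) \<in> ideal_mod n"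
    using A by simp
  then show ?case using A step.hyps by (intro exI[of _ "insert w A"] exI[of _ c']) auto
qed

lemma dense_increasing_words:
  assumes "f \<in> free_carrier (H_gens N)"
  shows "\<exists>A c. finite A \<and> A \<subseteq> increasing_words N \<and>
      (\<exists>b\<in>free_carrier (H_gens N).
        f - ((\<Sum>w\<in>A. scalar_series (c w) * word_series w) + fps_X ^ n * b) \<in> J)"
proof -
  obtain A c where A: "finite A" "A \<subseteq> increasing_words N"
    "f - (\<Sum>w\<in>A. scalar_series (c w) * word_series w) \<in> ideal_mod n"
    using word_span_expansion[OF free_carrier_subset_word_span[OF assms]] by blast
  then obtain a b where ab: "a \<in> J" "b \<in> free_carrier (H_gens N)"
    "f - (\<Sum>w\<in>A. scalar_series (c w) * word_series w) = a + fps_X ^ n * b"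
    by (auto simp: ideal_mod_def)
  then have "f - ((\<Sum>w\<in>A. scalar_series (c w) * word_series w) + fps_X ^ n * b) = a"
    by (simp add: algebra_simps)
  then show ?thesis using A ab by blast
qed

end

section \<open>Actions of completed free algebras\<close>

text \<open>
  The transpose of a representation. As it acts on all functions, no finiteness conditions arise.
\<close>

locale dual_representation =
  fixes act :: "'g \<Rightarrow> ('m \<Rightarrow> complex poly fps) \<Rightarrow> 'm \<Rightarrow> complex poly fps"
  assumes act_add: "act g (\<lambda>m. \<phi> m + \<psi> m) = (\<lambda>m. act g \<phi> m + act g \<psi> m)"
    and act_scale: "act g (\<lambda>m. c * \<phi> m) = (\<lambda>m. c * act g \<phi> m)"
begin

text \<open>A functional composed with a product g_1 g_2 of operators is obtained by applying first
  the transpose of g_1 and then that of g_2; hence \<open>fold\<close> over the letters in reading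
  order.\<close>

definition act_word :: "'g fword \<Rightarrow> ('m \<Rightarrow> complex poly fps) \<Rightarrow> 'm \<Rightarrow> complex poly fps" where
  "act_word w = fold act (letters w)"

lemma act_word_add: "act_word w (\<lambda>m. \<phi> m + \<psi> m) = (\<lambda>m. act_word w \<phi> m + act_word w \<psi> m)"
proof -
  have "fold act gs (\<lambda>m. \<phi> m + \<psi> m) = (\<lambda>m. fold act gs \<phi> m + fold act gs \<psi> m)" for gs
    by (induction gs arbitrary: \<phi> \<psi>) (simp_all add: act_add)
  then show ?thesis by (simp add: act_word_def)
qed

lemma act_word_scale: "act_word w (\<lambda>m. c * \<phi> m) = (\<lambda>m. c * act_word w \<phi> m)"
proof -
  have "fold act gs (\<lambda>m. c * \<phi> m) = (\<lambda>m. c * fold act gs \<phi> m)" for gs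
    by (induction gs arbitrary: \<phi>) (simp_all add: act_scale)
  then show ?thesis by (simp add: act_word_def)
qed

lemma act_word_sum:
  "act_word w (\<lambda>m. \<Sum>i\<in>A. \<phi> i m) = (\<lambda>m. \<Sum>i\<in>A. act_word w (\<phi> i) m)"
proof (induction A rule: infinite_finite_induct)
  case (insert a A)
  then show ?case by (simp add: act_word_add)
qed (use act_word_scale[of w 0] in simp_all)

lemma act_word_0 [simp]: "act_word 0 \<phi> = \<phi>"
  by (simp add: act_word_def zero_fword_def)

lemma act_word_plus: "act_word (v + w) \<phi> = act_word w (act_word v \<phi>)"
  by (simp add: act_word_def plus_fword_def)

definition act_poly ::
  "('g fword \<Rightarrow>\<^sub>0 complex) \<Rightarrow> ('m \<Rightarrow> complex poly fps) \<Rightarrow> 'm \<Rightarrow> complex poly fps" where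
  "act_poly p \<phi> m =
    (\<Sum>w\<in>Poly_Mapping.keys p. fps_const [:Poly_Mapping.lookup p w:] * act_word w \<phi> m)"

lemma act_poly_superset:
  assumes "finite A" "Poly_Mapping.keys p \<subseteq> A"
  shows "act_poly p \<phi> m = (\<Sum>w\<in>A. fps_const [:Poly_Mapping.lookup p w:] * act_word w \<phi> m)"
  unfolding act_poly_def
  by (rule sum.mono_neutral_left) (use assms in \<open>auto simp: in_keys_iff\<close>)

lemma act_poly_add: "act_poly (p + q) \<phi> m = act_poly p \<phi> m + act_poly q \<phi> m"
proof -
  let ?A = "Poly_Mapping.keys p \<union> Poly_Mapping.keys q"
  have "act_poly (p + q) \<phi> m =
      (\<Sum>w\<in>?A. fps_const [:Poly_Mapping.lookup (p + q) w:] * act_word w \<phi> m)"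
    by (rule act_poly_superset) (use keys_add[of p q] in auto)
  also have "\<dots> = (\<Sum>w\<in>?A. fps_const [:Poly_Mapping.lookup p w:] * act_word w \<phi> m) +
      (\<Sum>w\<in>?A. fps_const [:Poly_Mapping.lookup q w:] * act_word w \<phi> m)"
    unfolding sum.distrib[symmetric] distrib_right[symmetric] fps_const_add
    by (simp add: lookup_add)
  also have "\<dots> = act_poly p \<phi> m + act_poly q \<phi> m"
    by (simp add: act_poly_superset[of ?A])
  finally show ?thesis .
qed

lemma act_poly_0 [simp]: "act_poly 0 \<phi> m = 0"
  by (simp add: act_poly_def)

lemma act_poly_single: "act_poly (Poly_Mapping.single w c) \<phi> m = fps_const [:c:] * act_word w \<phi> m"
  by (simp add: act_poly_def)

lemma act_poly_sum: "act_poly (\<Sum>i\<in>A. p i) \<phi> m = (\<Sum>i\<in>A. act_poly (p i) \<phi> m)"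
  by (induction A rule: infinite_finite_induct) (simp_all add: act_poly_add)

lemma act_poly_add_arg:
  "act_poly p (\<lambda>m. \<phi> m + \<psi> m) m = act_poly p \<phi> m + act_poly p \<psi> m"
  by (simp add: act_poly_def act_word_add distrib_left sum.distrib)

lemma act_poly_scale_arg: "act_poly p (\<lambda>m. c * \<phi> m) m = c * act_poly p \<phi> m"
  by (simp add: act_poly_def act_word_scale sum_distrib_left mult.left_commute)

lemma act_poly_mult: "act_poly (p * q) \<phi> m = act_poly q (act_poly p \<phi>) m"
proof -
  let ?c = "\<lambda>p w. fps_const [:Poly_Mapping.lookup p w:] :: complex poly fps"
  have "p * q = (\<Sum>w\<in>Poly_Mapping.keys q. \<Sum>v\<in>Poly_Mapping.keys p.
      Poly_Mapping.single (v + w) (Poly_Mapping.lookup p v * Poly_Mapping.lookup q w))"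
    by (subst single_expansion[of p], subst single_expansion[of q], subst sum.swap)
      (simp add: sum_product mult_single)
  then have "act_poly (p * q) \<phi> m = (\<Sum>w\<in>Poly_Mapping.keys q. \<Sum>v\<in>Poly_Mapping.keys p.
      ?c q w * (?c p v * act_word w (act_word v \<phi>) m))"
    by (simp add: act_poly_sum act_poly_single act_word_plus mult.assoc[symmetric] mult.commute)
  also have "\<dots> = (\<Sum>w\<in>Poly_Mapping.keys q. ?c q w *
      act_word w (\<lambda>m. \<Sum>v\<in>Poly_Mapping.keys p. ?c p v * act_word v \<phi> m) m)"
    by (simp add: act_word_sum act_word_scale sum_distrib_left)
  also have "\<dots> = act_poly q (act_poly p \<phi>) m"
    unfolding act_poly_def[of q] act_poly_def[of p, abs_def] ..
  finally show ?thesis .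
qed

text \<open>A Cauchy product in h, since the values of the action are series in h themselves. Every
  coefficient is a finite sum, so no convergence in the module is involved.\<close>

definition act_series ::
  "'g free_series \<Rightarrow> ('m \<Rightarrow> complex poly fps) \<Rightarrow> 'm \<Rightarrow> complex poly fps" where
  "act_series f \<phi> m = Abs_fps (\<lambda>n. \<Sum>k\<le>n. act_poly (f $ k) \<phi> m $ (n - k))"

lemma act_series_add: "act_series (f + g) \<phi> m = act_series f \<phi> m + act_series g \<phi> m"
  by (rule fps_ext) (simp add: act_series_def act_poly_add sum.distrib)

lemma act_series_0 [simp]: "act_series 0 \<phi> m = 0"
  by (rule fps_ext) (simp add: act_series_def)

lemma act_series_uminus: "act_series (- f) \<phi> m = - act_series f \<phi> m"
  using act_series_add[of f "- f" \<phi> m] by (simp add: eq_neg_iff_add_eq_0 add.commute)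

lemma act_series_diff: "act_series (f - g) \<phi> m = act_series f \<phi> m - act_series g \<phi> m"
  using act_series_add[of f "- g" \<phi> m] by (simp add: act_series_uminus)

lemma act_series_sum: "act_series (\<Sum>i\<in>A. f i) \<phi> m = (\<Sum>i\<in>A. act_series (f i) \<phi> m)"
  by (induction A rule: infinite_finite_induct) (simp_all add: act_series_add)

lemma act_series_add_arg:
  "act_series f (\<lambda>m. \<phi> m + \<psi> m) m = act_series f \<phi> m + act_series f \<psi> m"
  by (rule fps_ext) (simp add: act_series_def act_poly_add_arg sum.distrib)

lemma act_series_fps_X_arg: "act_series f (\<lambda>m. fps_X * \<phi> m) m = fps_X * act_series f \<phi> m"
proof (rule fps_ext)
  fix n
  show "act_series f (\<lambda>m. fps_X * \<phi> m) m $ n = (fps_X * act_series f \<phi> m) $ n"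
  proof (cases n)
    case (Suc l)
    have "(\<Sum>k\<le>l. (fps_X * act_poly (f $ k) \<phi> m) $ (Suc l - k)) =
        (\<Sum>k\<le>l. act_poly (f $ k) \<phi> m $ (l - k))"
      by (rule sum.cong) (auto simp: Suc_diff_le)
    then show ?thesis by (simp add: Suc act_series_def act_poly_scale_arg)
  qed (simp add: act_series_def act_poly_scale_arg)
qed

lemma act_series_fps_const: "act_series (fps_const p) \<phi> m = act_poly p \<phi> m"
proof (rule fps_ext)
  fix n
  have "(\<Sum>k\<le>n. act_poly (fps_const p $ k) \<phi> m $ (n - k)) =
      (\<Sum>k\<le>n. if k = 0 then act_poly p \<phi> m $ n else 0)"
    by (rule sum.cong) auto
  then show "act_series (fps_const p) \<phi> m $ n = act_poly p \<phi> m $ n"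
    by (simp add: act_series_def)
qed

lemma act_series_fps_X_mult: "act_series (fps_X * f) \<phi> m = fps_X * act_series f \<phi> m"
proof (rule fps_ext)
  fix n
  show "act_series (fps_X * f) \<phi> m $ n = (fps_X * act_series f \<phi> m) $ n"
  proof (cases n)
    case (Suc l)
    have "(\<Sum>k\<le>Suc l. act_poly ((fps_X * f) $ k) \<phi> m $ (Suc l - k)) =
        (\<Sum>k\<le>l. act_poly (f $ k) \<phi> m $ (l - k))"
      by (subst sum.atMost_Suc_shift) simp
    then show ?thesis by (simp add: Suc act_series_def)
  qed (simp add: act_series_def)
qed

lemma act_series_fps_X_power_mult: "act_series (fps_X ^ n * f) \<phi> m = fps_X ^ n * act_series f \<phi> m"
  by (induction n) (simp_all add: act_series_fps_X_mult mult.assoc)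

lemma fps_decompose: "f = fps_const (f $ 0) + fps_X * fps_shift 1 f"
  for f :: "'a::ring_1 fps"
  by (rule fps_ext) auto

lemma act_series_decompose:
  "act_series f \<phi> m = act_poly (f $ 0) \<phi> m + fps_X * act_series (fps_shift 1 f) \<phi> m"
  using act_series_add[of "fps_const (f $ 0)" "fps_X * fps_shift 1 f" \<phi> m]
  unfolding fps_decompose[symmetric] by (simp add: act_series_fps_const act_series_fps_X_mult)

text \<open>By induction on the power of h. Once the constant terms of \<open>f\<close> and
  \<open>g\<close> are split off, the products of these terms agree on both sides, and the rest is h
  times two instances of the claim, for which the preceding power is enough.\<close>

lemma act_series_mult: "act_series (f * g) \<phi> m = act_series g (act_series f \<phi>) m"
proof (rule fps_ext)
  fix n
  show "act_series (f * g) \<phi> m $ n = act_series g (act_series f \<phi>) m $ n"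
  proof (induction n arbitrary: f g \<phi> m rule: less_induct)
    case (less n)
    define f0 f' g0 g' where "f0 = f $ 0" "f' = fps_shift 1 f" "g0 = g $ 0" "g' = fps_shift 1 g"
    note defs = this
    have f: "f = fps_const f0 + fps_X * f'" and g: "g = fps_const g0 + fps_X * g'"
      using fps_decompose[of f] fps_decompose[of g] by (simp_all add: defs)
    have af: "act_series f \<phi> m = act_poly f0 \<phi> m + fps_X * act_series f' \<phi> m" for \<phi> m
      unfolding defs by (rule act_series_decompose)
    have ag: "act_series g \<phi> m = act_poly g0 \<phi> m + fps_X * act_series g' \<phi> m" for \<phi> m
      unfolding defs by (rule act_series_decompose)
    have "fps_const f0 * fps_X = fps_X * fps_const f0"
      by (rule fps_mult_fps_X_commute[symmetric])
    then have "fps_const f0 * g = fps_const (f0 * g0) + fps_X * (fps_const f0 * g')"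
      by (subst g) (simp add: distrib_left flip: mult.assoc)
    then have "f * g = fps_const (f0 * g0) + fps_X * (fps_const f0 * g' + f' * g)"
      by (subst f) (simp add: distrib_left distrib_right mult.assoc)
    then have L: "act_series (f * g) \<phi> m = act_poly g0 (act_poly f0 \<phi>) m +
        fps_X * (act_series (fps_const f0 * g') \<phi> m + act_series (f' * g) \<phi> m)"
      by (simp add: act_series_add act_series_fps_X_mult act_series_fps_const act_poly_mult)
    have "act_series f \<phi> = (\<lambda>m. act_poly f0 \<phi> m + fps_X * act_series f' \<phi> m)"
      by (simp add: af fun_eq_iff)
    then have "act_series g (act_series f \<phi>) m =
        act_series g (act_poly f0 \<phi>) m + fps_X * act_series g (act_series f' \<phi>) m"
      by (simp add: act_series_add_arg act_series_fps_X_arg)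
    also have "act_poly f0 \<phi> = act_series (fps_const f0) \<phi>"
      by (simp add: act_series_fps_const fun_eq_iff)
    finally have R: "act_series g (act_series f \<phi>) m = act_poly g0 (act_poly f0 \<phi>) m +
        fps_X * (act_series g' (act_series (fps_const f0) \<phi>) m + act_series g (act_series f' \<phi>) m)"
      by (simp add: ag distrib_left act_series_fps_const[abs_def])
    show ?case
    proof (cases n)
      case (Suc l)
      then show ?thesis unfolding L R using less.IH[of l] by simp
    qed (simp add: L R)
  qed
qed

lemma act_series_gen_series: "act_series (gen_series g) \<phi> m = act g \<phi> m"
  by (simp add: gen_series_def act_series_fps_const act_poly_single act_word_def one_pCons[symmetric])

lemma act_series_1 [simp]: "act_series 1 \<phi> m = \<phi> m"
  using act_series_fps_const[of 1 \<phi> m]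
  by (simp add: act_poly_def one_pCons[symmetric])

lemma act_series_scalar_series:
  "act_series (scalar_series c) \<phi> m = Abs_fps (\<lambda>k. [:c $ k:]) * \<phi> m"
proof (rule fps_ext)
  fix n
  show "act_series (scalar_series c) \<phi> m $ n = (Abs_fps (\<lambda>k. [:c $ k:]) * \<phi> m) $ n"
    unfolding fps_mult_nth atLeast0AtMost
    by (simp add: act_series_def scalar_series_def act_poly_single)
qed

lemma act_series_scalar_series_mult:
  "act_series (scalar_series c * f) \<phi> m = Abs_fps (\<lambda>k. [:c $ k:]) * act_series f \<phi> m"
  by (simp add: scalar_series_commute act_series_mult act_series_scalar_series)

end

locale presentation_dual_representation = presentation X rels + dual_representation act
  for X :: "'g set" and rels and act :: "'g \<Rightarrow> ('m \<Rightarrow> complex poly fps) \<Rightarrow> 'm \<Rightarrow> complex poly fps" +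
  assumes act_rels: "f \<in> rels \<Longrightarrow> act_series f \<phi> m = 0"
begin

text \<open>The elements \<open>K\<close> that annihilate all functionals form a two-sided ideal
  containing the relators. The passage from the ideal to its closure is made separately for each
  coefficient.\<close>

lemma act_series_J:
  assumes "f \<in> J"
  shows "act_series f \<phi> m = 0"
proof (rule fps_ext)
  fix n
  define K where "K = {f \<in> free_carrier X. \<forall>\<phi> m. act_series f \<phi> m = 0}"
  have "ideal K (completed_free_algebra X)"
  proof (rule idealI)
    show "subgroup K (add_monoid (completed_free_algebra X))"
    proof (rule group.subgroupI)
      show "Group.group (add_monoid (completed_free_algebra X))" by (rule F.a_group)
      show "K \<subseteq> carrier (add_monoid (completed_free_algebra X))" by (auto simp: K_def)
      show "K \<noteq> {}" by (auto simp: K_def intro: exI[of _ 0])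
      show "inv\<^bsub>add_monoid (completed_free_algebra X)\<^esub> a \<in> K" if "a \<in> K" for a
        using that a_inv_completed_free_algebra[of a X]
        by (auto simp: a_inv_def K_def act_series_uminus)
      show "a \<otimes>\<^bsub>add_monoid (completed_free_algebra X)\<^esub> b \<in> K" if "a \<in> K" "b \<in> K" for a b
        using that by (auto simp: K_def act_series_add)
    qed
  next
    fix a x assume a: "a \<in> K" and x: "x \<in> free_carrier X"
    have "act_series a \<phi> = (\<lambda>m. 0)" for \<phi> using a by (auto simp: K_def)
    moreover have "act_series x (\<lambda>m. 0) m = 0" for m
      using act_series_fps_X_arg[of x "\<lambda>m. 0" m] act_series_add_arg[of x "\<lambda>m. 0" "\<lambda>m. 0" m] by simp
    ultimately have "act_series (a * x) \<phi> m = 0" for \<phi> m by (simp add: act_series_mult)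
    then show "a \<otimes>\<^bsub>completed_free_algebra X\<^esub> x \<in> K" using a x by (simp add: K_def)
    show "x \<otimes>\<^bsub>completed_free_algebra X\<^esub> a \<in> K" using a x by (simp add: K_def act_series_mult)
  qed (rule ring_completed_free_algebra)
  moreover have "rels \<subseteq> K" using act_rels rels_subset by (auto simp: K_def)
  ultimately have K: "Idl\<^bsub>completed_free_algebra X\<^esub> rels \<subseteq> K" by (rule F.genideal_minimal)
  \<comment> \<open>The exponent \<open>Suc n\<close> moves the remainder beyond the coefficient of
    h^n under consideration.\<close>
  obtain a b where "a \<in> Idl\<^bsub>completed_free_algebra X\<^esub> rels" "f = a + fps_X ^ Suc n * b"
    using assms by (rule J_E)
  then have "act_series f \<phi> m = fps_X ^ Suc n * act_series b \<phi> m"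
    using K by (auto simp: K_def act_series_add act_series_fps_X_power_mult simp del: power_Suc)
  then show "act_series f \<phi> m $ n = 0 $ n"
    by (simp add: fps_X_power_mult_nth del: power_Suc)
qed

end

section \<open>Linear independence\<close>

lemma fps_const_pCons_sum: "fps_const [:sum c A:] = (\<Sum>i\<in>A. fps_const [:c i:])"
proof (induction A rule: infinite_finite_induct)
  case (insert x A)
  have "[:sum c (insert x A):] = [:c x:] + [:sum c A:]" using insert.hyps by simp
  then show ?case
    by (simp only: sum.insert[OF insert.hyps] insert.IH flip: fps_const_add)
qed simp_all

lemma fps_const_pCons_mult:
  "fps_const [:a:] * (fps_const [:b:] * f) = fps_const [:a * b:] * f" for a b :: "'a::comm_ring_1"
proof -
  have "[:a:] * [:b:] = [:a * b:]" by simp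
  then show ?thesis by (simp only: fps_const_mult flip: mult.assoc)
qed

text \<open>Completed by the diagonal terms, either side is the full double sum over
  \<open>M\<close>, and the diagonal can be cancelled. For the operators below it says that two
  derivations commute.\<close>

lemma sum_mset_remove1_swap:
  fixes F :: "'a \<Rightarrow> 'a \<Rightarrow> 'b::cancel_comm_monoid_add"
  shows "(\<Sum>e\<in>#M. \<Sum>d\<in>#M - {#e#}. F e d) = (\<Sum>e\<in>#M. \<Sum>d\<in>#M - {#e#}. F d e)"
proof -
  have *: "(\<Sum>e\<in>#M. \<Sum>d\<in>#M - {#e#}. G e d) + (\<Sum>e\<in>#M. G e e) = (\<Sum>e\<in>#M. \<Sum>d\<in>#M. G e d)"
    for G :: "'a \<Rightarrow> 'a \<Rightarrow> 'b"
  proof -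
    have "(\<Sum>d\<in>#M - {#e#}. G e d) + G e e = (\<Sum>d\<in>#M. G e d)" if e: "e \<in># M" for e
    proof -
      obtain M' where "M = add_mset e M'" using e by (metis multi_member_split)
      then show ?thesis by (simp add: add.commute)
    qed
    then have "image_mset (\<lambda>e. (\<Sum>d\<in>#M - {#e#}. G e d) + G e e) M = image_mset (\<lambda>e. \<Sum>d\<in>#M. G e d) M"
      by (intro image_mset_cong)
    then show ?thesis by (simp flip: sum_mset.distrib)
  qed
  show ?thesis
    by (rule add_right_imp_eq[OF trans[OF *[of F] trans[OF sum_mset.swap *[of "\<lambda>e d. F d e", symmetric]]]])
qed

context hat_basis
begin

section \<open>Multiplication by variables plus derivations\<close>

definition \<omega> :: "nat \<times> int \<Rightarrow> nat \<times> int \<Rightarrow> complex poly fps" where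
  "\<omega> a d = (if fst a = fst d \<and> snd d < snd a then \<gamma> N (snd a) (snd d) else 0)"

text \<open>
  The transpose of multiplication by the variable \<open>a\<close> plus the derivation that maps each variable
  \<open>d\<close> to \<open>\<omega> a d\<close>, on polynomials with the multisets as basis of monomials.
\<close>

definition yop ::
  "nat \<times> int \<Rightarrow> ((nat \<times> int) multiset \<Rightarrow> complex poly fps) \<Rightarrow> (nat \<times> int) multiset \<Rightarrow> complex poly fps" where
  "yop a \<phi> M = \<phi> (add_mset a M) + (\<Sum>d\<in>#M. \<omega> a d * \<phi> (M - {#d#}))"

lemma yop_add: "yop a (\<lambda>M. \<phi> M + \<psi> M) M = yop a \<phi> M + yop a \<psi> M"
  by (simp add: yop_def distrib_left sum_mset.distrib)

lemma yop_scale: "yop a (\<lambda>M. c * \<phi> M) M = c * yop a \<phi> M"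
  by (simp add: yop_def distrib_left sum_mset_distrib_left mult.left_commute)

lemma yop_sum: "yop a (\<lambda>M. \<Sum>i\<in>A. \<phi> i M) M = (\<Sum>i\<in>A. yop a (\<phi> i) M)"
proof (induction A rule: infinite_finite_induct)
  case (insert x A)
  then show ?case by (simp add: yop_add)
qed (simp_all add: yop_def)

text \<open>Write x_a for the variables and D_a for the derivations. The terms of (x_a + D_a)(x_b +
  D_b) on a monomial are, in this order, x_a x_b, the scalar D_a(x_b), the mixed terms x_b D_a and
  x_a D_b, and D_a D_b.\<close>

lemma yop_yop:
  "yop b (yop a \<phi>) M = \<phi> (add_mset a (add_mset b M)) + \<omega> a b * \<phi> M
    + ((\<Sum>d\<in>#M. \<omega> a d * \<phi> (add_mset b (M - {#d#}))) + (\<Sum>e\<in>#M. \<omega> b e * \<phi> (add_mset a (M - {#e#}))))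
    + (\<Sum>e\<in>#M. \<Sum>d\<in>#M - {#e#}. \<omega> b e * (\<omega> a d * \<phi> (M - {#e#} - {#d#})))"
proof -
  have "image_mset (\<lambda>d. \<omega> a d * \<phi> (add_mset b M - {#d#})) M =
      image_mset (\<lambda>d. \<omega> a d * \<phi> (add_mset b (M - {#d#}))) M"
    by (rule image_mset_cong) (auto dest!: multi_member_split)
  then have "yop a \<phi> (add_mset b M) = \<phi> (add_mset a (add_mset b M)) +
      (\<omega> a b * \<phi> M + (\<Sum>d\<in>#M. \<omega> a d * \<phi> (add_mset b (M - {#d#}))))"
    by (simp add: yop_def)
  then show ?thesis
    by (simp add: yop_def[of b] yop_def[of a _ "M - _"] distrib_left sum_mset.distrib sum_mset_distrib_left)
qed

text \<open>The derivations take scalar values on variables, so they commute with each other; the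
  mixed terms are symmetric, and D_a(x_b) - D_b(x_a) is left.\<close>

lemma yop_commutator: "yop b (yop a \<phi>) M - yop a (yop b \<phi>) M = (\<omega> a b - \<omega> b a) * \<phi> M"
proof -
  have "(\<Sum>e\<in>#M. \<Sum>d\<in>#M - {#e#}. \<omega> b e * (\<omega> a d * \<phi> (M - {#e#} - {#d#}))) =
    (\<Sum>e\<in>#M. \<Sum>d\<in>#M - {#e#}. \<omega> b d * (\<omega> a e * \<phi> (M - {#d#} - {#e#})))"
    by (rule sum_mset_remove1_swap)
  also have "\<dots> = (\<Sum>e\<in>#M. \<Sum>d\<in>#M - {#e#}. \<omega> a e * (\<omega> b d * \<phi> (M - {#e#} - {#d#})))"
    by (simp add: mult.left_commute diff_diff_add_mset add_mset_commute)
  finally show ?thesis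
    unfolding yop_yop by (simp add: add_mset_commute[of a b] left_diff_distrib)
qed

text \<open>For s < r the first term contributes, for r < s the second one by antisymmetry, and for
  r = s the structure constant is 0.\<close>

lemma \<omega>_diff: "\<omega> (k, r) (l, s) - \<omega> (l, s) (k, r) = (if k = l then \<gamma> N r s else 0)"
  using \<gamma>_swap[of N r s] \<gamma>_swap[of N r r] by (auto simp: \<omega>_def \<gamma>_def)

text \<open>The generator y_i^(r) acts through the coordinates of a_i in the orthonormal basis, and
  C as the polynomial variable of the scalars.\<close>

fun gen_act ::
  "gen \<Rightarrow> ((nat \<times> int) multiset \<Rightarrow> complex poly fps) \<Rightarrow> (nat \<times> int) multiset \<Rightarrow> complex poly fps" where
  "gen_act GC \<phi> M = fps_const [:0, 1:] * \<phi> M"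
| "gen_act (GY i r) \<phi> M = (\<Sum>k=1..N-1. fps_const [:\<mu> i k:] * yop (k, r) \<phi> M)"

sublocale dual_representation gen_act
proof
  fix g \<phi> \<psi> c
  show "gen_act g (\<lambda>m. \<phi> m + \<psi> m) = (\<lambda>m. gen_act g \<phi> m + gen_act g \<psi> m)"
    by (cases g) (auto simp: fun_eq_iff yop_add distrib_left sum.distrib)
  show "gen_act g (\<lambda>m. c * \<phi> m) = (\<lambda>m. c * gen_act g \<phi> m)"
    by (cases g) (auto simp: fun_eq_iff yop_scale sum_distrib_left mult.left_commute)
qed

lemma act_series_central_series: "act_series (central_series p) \<phi> M = p * \<phi> M"
proof (rule fps_ext)
  fix n
  have rep: "act_word (FWord (replicate l GC)) \<phi> M = fps_const ([:0, 1:] ^ l) * \<phi> M" for l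
  proof -
    have "fold gen_act (replicate l GC) \<phi> = (\<lambda>M. fps_const ([:0, 1:] ^ l) * \<phi> M)"
    proof (induction l arbitrary: \<phi>)
      case (Suc l)
      have "gen_act GC \<phi> = (\<lambda>M. fps_const [:0, 1:] * \<phi> M)" by (simp add: fun_eq_iff)
      then show ?case
        by (simp only: replicate.simps fold_simps comp_def Suc.IH power_Suc2 fps_const_mult[symmetric] mult.assoc)
    qed simp
    then show ?thesis by (simp add: act_word_def)
  qed
  have "act_poly (central_series p $ k) \<phi> M = fps_const (p $ k) * \<phi> M" for k
  proof -
    have "act_poly (central_series p $ k) \<phi> M =
        (\<Sum>l\<le>degree (p $ k). fps_const [:coeff (p $ k) l:] * (fps_const ([:0, 1:] ^ l) * \<phi> M))"
      by (simp add: central_series_def act_poly_sum act_poly_single rep)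
    also have "\<dots> = fps_const (\<Sum>l\<le>degree (p $ k). monom (coeff (p $ k) l) l) * \<phi> M"
      by (simp add: fps_const_sum sum_distrib_right monom_altdef flip: mult.assoc)
    finally show ?thesis by (simp only: poly_as_sum_of_monoms)
  qed
  then show "act_series (central_series p) \<phi> M $ n = (p * \<phi> M) $ n"
    unfolding fps_mult_nth atLeast0AtMost by (simp add: act_series_def)
qed

lemma act_series_y_coeff: "r \<noteq> 0 \<Longrightarrow> act_series (y_coeff i r) \<phi> M = gen_act (GY i r) \<phi> M"
  by (simp add: y_coeff_def act_series_gen_series)

text \<open>Operators belonging to different basis vectors commute, so only equal indices
  contribute, each with the same structure constant; Parseval's identity then produces <a_i,
  a_j>.\<close>

lemma act_series_y_coeff_commutator:
  assumes "i \<in> {1..N}" "j \<in> {1..N}"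
  shows "act_series (y_coeff i r * y_coeff j s) \<phi> M - act_series (y_coeff j s * y_coeff i r) \<phi> M =
    fps_const [:(if i = j then 1 else 0) - 1 / of_nat N:] * (\<gamma> N r s * \<phi> M)"
proof (cases "r = 0 \<or> s = 0")
  case True
  then show ?thesis by (auto simp: y_coeff_def \<gamma>_0)
next
  case False
  let ?c = "\<lambda>i k. fps_const [:\<mu> i k:] :: complex poly fps"
  have prod: "act_series (y_coeff i r * y_coeff j s) \<phi> M =
      (\<Sum>l=1..N-1. \<Sum>k=1..N-1. ?c i k * (?c j l * yop (l, s) (yop (k, r) \<phi>) M))"
    if "r \<noteq> 0" "s \<noteq> 0" for i j r s
  proof -
    have "act_series (y_coeff i r) \<phi> = (\<lambda>M. \<Sum>k=1..N-1. ?c i k * yop (k, r) \<phi> M)"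
      using that by (simp add: fun_eq_iff act_series_y_coeff)
    then show ?thesis
      using that by (simp add: act_series_mult act_series_y_coeff yop_sum yop_scale sum_distrib_left
          mult.left_commute[of "?c j _" "?c i _"])
  qed
  have "act_series (y_coeff i r * y_coeff j s) \<phi> M - act_series (y_coeff j s * y_coeff i r) \<phi> M =
      (\<Sum>l=1..N-1. \<Sum>k=1..N-1. ?c i k * (?c j l * (yop (l, s) (yop (k, r) \<phi>) M - yop (k, r) (yop (l, s) \<phi>) M)))"
  proof -
    have "act_series (y_coeff j s * y_coeff i r) \<phi> M =
        (\<Sum>l=1..N-1. \<Sum>k=1..N-1. ?c i k * (?c j l * yop (k, r) (yop (l, s) \<phi>) M))"
      using False by (subst sum.swap) (simp add: prod mult.left_commute)
    then show ?thesis
      using False by (simp add: prod right_diff_distrib sum_subtractf)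
  qed
  also have "\<dots> = (\<Sum>l=1..N-1. ?c i l * (?c j l * (\<gamma> N r s * \<phi> M)))"
  proof (rule sum.cong[OF refl])
    fix l assume "l \<in> {1..N-1}"
    moreover have "(\<Sum>k=1..N-1. ?c i k * (?c j l * (yop (l, s) (yop (k, r) \<phi>) M - yop (k, r) (yop (l, s) \<phi>) M))) =
        (\<Sum>k=1..N-1. if k = l then ?c i l * (?c j l * (\<gamma> N r s * \<phi> M)) else 0)"
      by (rule sum.cong[OF refl]) (simp add: yop_commutator \<omega>_diff)
    ultimately show "(\<Sum>k=1..N-1. ?c i k * (?c j l * (yop (l, s) (yop (k, r) \<phi>) M - yop (k, r) (yop (l, s) \<phi>) M))) =
        ?c i l * (?c j l * (\<gamma> N r s * \<phi> M))"
      by simp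
  qed
  also have "\<dots> = fps_const [:\<Sum>l=1..N-1. \<mu> i l * \<mu> j l:] * (\<gamma> N r s * \<phi> M)"
    by (simp only: fps_const_pCons_sum sum_distrib_right fps_const_pCons_mult)
  finally show ?thesis by (simp only: sum_\<mu>_\<mu>[OF assms])
qed

text \<open>C acts by a scalar and hence is central, the quadratic relators vanish by the commutator
  formula, and the linear ones because the coordinates \<open>\<mu> i k\<close> sum to 0 over
  i.\<close>

sublocale presentation_dual_representation "H_gens N" "H_rels N" gen_act
proof
  fix f \<phi> M assume "f \<in> H_rels N"
  then consider g where "f = gen_series GC * gen_series g - gen_series g * gen_series GC"
    | i j r s where "f = yy_relator N i j r s" "i \<in> {1..N}" "j \<in> {1..N}"
    | r where "f = (\<Sum>i=1..N. y_coeff i r)"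
    unfolding H_rels_def by blast
  then show "act_series f \<phi> M = 0"
  proof cases
    case 1
    have "gen_act GC \<phi> = (\<lambda>M. fps_const [:0, 1:] * \<phi> M)" for \<phi> by (simp add: fun_eq_iff)
    then show ?thesis
      by (simp add: 1 act_series_diff act_series_mult act_series_gen_series[abs_def] act_scale)
  next
    case 2
    let ?d = "fps_const [:(if i = j then 1 else 0) - 1 / of_nat N:] :: complex poly fps"
    have "act_series f \<phi> M =
      (act_series (y_coeff i r * y_coeff j s) \<phi> M - act_series (y_coeff j s * y_coeff i r) \<phi> M)
      + ?d * s_factor_coeff N (- r - 1) (- s - 1) * \<phi> M
      - ?d * s_factor_coeff N (- s - 1) (- r - 1) * \<phi> M"
      using N_ge_2 2(2,3)
      by (simp add: 2(1) yy_relator_def act_series_diff act_series_add act_series_central_series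
          subst_coeff_s_series del: fps_const_minus fps_const_sub)
    also have "\<dots> = 0"
      unfolding act_series_y_coeff_commutator[OF 2(2,3)] \<gamma>_def by (simp add: algebra_simps)
    finally show ?thesis .
  next
    case 3
    show ?thesis
    proof (cases "r = 0")
      case False
      have "(\<Sum>i=1..N. \<Sum>k=1..N-1. fps_const [:\<mu> i k:] * yop (k, r) \<phi> M) =
        (\<Sum>k=1..N-1. fps_const [:\<Sum>i=1..N. \<mu> i k:] * yop (k, r) \<phi> M)"
        by (subst sum.swap) (simp add: fps_const_pCons_sum sum_distrib_right)
      also have "\<dots> = 0" by (simp only: sum_\<mu>) simp
      finally show ?thesis using False by (simp add: 3 act_series_sum act_series_y_coeff)
    qed (simp add: 3 y_coeff_def)
  qed
qed

section \<open>Evaluation of increasing words\<close>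

fun hat_act ::
  "gen \<Rightarrow> ((nat \<times> int) multiset \<Rightarrow> complex poly fps) \<Rightarrow> (nat \<times> int) multiset \<Rightarrow> complex poly fps" where
  "hat_act GC \<phi> = (\<lambda>M. fps_const [:0, 1:] * \<phi> M)"
| "hat_act (GY j r) \<phi> = yop (j, r) \<phi>"

text \<open>The j-th basis vector has a unit vector as its coordinates, so the combination of the
  y_i^(r) collapses to a single operator.\<close>

lemma act_series_hat_series:
  assumes "m \<in> hat_gens N"
  shows "act_series (hat_series m) \<phi> = hat_act m \<phi>"
proof (cases m)
  case GC
  then show ?thesis by (simp add: fun_eq_iff act_series_gen_series)
next
  case (GY j r)
  then have j: "j \<in> {1..N-1}" using assms by (simp add: GY_in_hat_gens)
  have const: "Abs_fps (\<lambda>k. [:fps_const c $ k:]) = fps_const [:c:]" for c :: complex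
    by (rule fps_ext) simp
  have "act_series (hat_series m) \<phi> M = yop (j, r) \<phi> M" for M
  proof -
    have "act_series (hat_series m) \<phi> M =
        (\<Sum>i=1..j. \<Sum>k=1..N-1. fps_const [:\<nu> i j * \<mu> i k:] * yop (k, r) \<phi> M)"
      unfolding GY hat_series.simps act_series_sum act_series_scalar_series_mult const
        act_series_gen_series gen_act.simps sum_distrib_left fps_const_pCons_mult ..
    also have "\<dots> = (\<Sum>k=1..N-1. fps_const [:\<Sum>i=1..j. \<nu> i j * \<mu> i k:] * yop (k, r) \<phi> M)"
      by (subst sum.swap) (simp add: fps_const_pCons_sum sum_distrib_right)
    also have "\<dots> = (\<Sum>k=1..N-1. if k = j then yop (k, r) \<phi> M else 0)"
      by (rule sum.cong[OF refl]) (use j in \<open>auto simp only: sum_\<nu>_\<mu>[OF j] one_pCons[symmetric], auto\<close>)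
    finally show ?thesis using j by simp
  qed
  then show ?thesis by (simp add: GY fun_eq_iff del: hat_series.simps)
qed

lemma act_series_word_series:
  "set ms \<subseteq> hat_gens N \<Longrightarrow> act_series (word_series ms) \<phi> = fold hat_act ms \<phi>"
proof (induction ms arbitrary: \<phi>)
  case (Cons m ms)
  have "act_series (word_series (m # ms)) \<phi> = act_series (word_series ms) (act_series (hat_series m) \<phi>)"
    by (simp add: fun_eq_iff act_series_mult)
  then show ?case using Cons by (simp add: act_series_hat_series)
qed (simp add: fun_eq_iff)

fun y_part :: "gen list \<Rightarrow> (nat \<times> int) multiset" where
  "y_part [] = {#}"
| "y_part (GC # ms) = y_part ms"
| "y_part (GY j r # ms) = add_mset (j, r) (y_part ms)"

lemma y_part_mem: "(j, r) \<in># y_part ms \<longleftrightarrow> GY j r \<in> set ms"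
  by (induction ms rule: y_part.induct) auto

lemma mset_eq_y_part:
  "mset ms = replicate_mset (count_list ms GC) GC + image_mset (\<lambda>(j, r). GY j r) (y_part ms)"
  by (induction ms rule: y_part.induct) auto

text \<open>Evaluation at \<open>{#}\<close> is evaluation on the polynomial 1. The functional is
  arbitrary in the induction because the first letter is transposed first and changes it. The
  derivation of that letter contributes nothing at \<open>y_part ms\<close>, since no variable there
  has a smaller upper index.\<close>

lemma fold_hat_act_increasing:
  "ms \<in> increasing_words N \<Longrightarrow>
    fold hat_act ms \<phi> {#} = fps_const (monom 1 (count_list ms GC)) * \<phi> (y_part ms)"
proof (induction ms arbitrary: \<phi>)
  case Nil
  then show ?case by (simp add: monom_0 one_pCons[symmetric])
next
  case (Cons m ms)
  then have ms: "ms \<in> increasing_words N" and m: "\<And>b. b \<in> set ms \<Longrightarrow> gen_less m b \<or> m = b"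
    by (auto simp: increasing_words_Cons)
  show ?case
  proof (cases m)
    case GC
    have "[:0, 1:] * monom 1 n = (monom 1 (Suc n) :: complex poly)" for n
      by (simp add: monom_Suc)
    then show ?thesis
      using Cons.IH[OF ms] by (simp add: GC mult.left_commute flip: mult.assoc)
  next
    case (GY j r)
    have "\<omega> (j, r) d = 0" if "d \<in># y_part ms" for d
      using m[of "GY (fst d) (snd d)"] that GY y_part_mem[of "fst d" "snd d" ms]
      by (auto simp: \<omega>_def)
    then have "image_mset (\<lambda>d. \<omega> (j, r) d * \<phi> (y_part ms - {#d#})) (y_part ms) =
        image_mset (\<lambda>d. 0) (y_part ms)"
      by (intro image_mset_cong) simp
    then have "yop (j, r) \<phi> (y_part ms) = \<phi> (add_mset (j, r) (y_part ms))"
      by (simp add: yop_def)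
    then show ?thesis using Cons.IH[OF ms] by (simp add: GY)
  qed
qed

text \<open>The head of an increasing word is the least letter of its multiset, so the heads agree
  and can be removed.\<close>

lemma increasing_words_mset_unique:
  "v \<in> increasing_words N \<Longrightarrow> w \<in> increasing_words N \<Longrightarrow> mset v = mset w \<Longrightarrow> v = w"
proof (induction v arbitrary: w)
  case (Cons a v)
  then obtain b w' where w: "w = b # w'" by (cases w) auto
  have "a \<in> set w" "b \<in> set (a # v)"
    using Cons.prems(3) by (metis list.set_intros(1) set_mset_mset w)+
  then have "a = b"
    using Cons.prems gen_less_antisym by (auto simp: w increasing_words_Cons)
  then show ?case using Cons by (simp add: w increasing_words_Cons)
qed simp

lemma increasing_words_eqI:
  assumes "v \<in> increasing_words N" "w \<in> increasing_words N"
    and "count_list v GC = count_list w GC" "y_part v = y_part w"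
  shows "v = w"
  using assms increasing_words_mset_unique mset_eq_y_part by metis

lemma increasing_words_independent:
  assumes A: "finite A" "A \<subseteq> increasing_words N" and v: "v \<in> A"
    and J: "(\<Sum>w\<in>A. scalar_series (c w) * word_series w) \<in> J"
  shows "c v = 0"
proof (rule fps_ext)
  fix k
  \<comment> \<open>This functional reads off the coefficient of the commutative monomial of
    \<open>v\<close>; the power of C in \<open>v\<close> is then isolated by
    \<open>coeff\<close>.\<close>
  define \<phi> :: "(nat \<times> int) multiset \<Rightarrow> complex poly fps" where "\<phi> M = of_bool (M = y_part v)" for M
  have "coeff ((Abs_fps (\<lambda>k. [:c w $ k:]) * act_series (word_series w) \<phi> {#}) $ k) (count_list v GC) =
      (if w = v then c w $ k else 0)" if "w \<in> A" for w
  proof -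
    have w: "w \<in> increasing_words N" using that A by blast
    then have "act_series (word_series w) \<phi> {#} = fps_const (monom 1 (count_list w GC)) * \<phi> (y_part w)"
      by (subst act_series_word_series) (auto simp: increasing_words_def intro!: fold_hat_act_increasing)
    then have "coeff ((Abs_fps (\<lambda>k. [:c w $ k:]) * act_series (word_series w) \<phi> {#}) $ k) (count_list v GC) =
        (if count_list w GC = count_list v GC \<and> y_part w = y_part v then c w $ k else 0)"
      by (auto simp: \<phi>_def)
    then show ?thesis using increasing_words_eqI[OF w] A v by auto
  qed
  then have "coeff ((\<Sum>w\<in>A. Abs_fps (\<lambda>k. [:c w $ k:]) * act_series (word_series w) \<phi> {#}) $ k)
      (count_list v GC) = c v $ k"
    using A v by (simp add: fps_sum_nth coeff_sum)
  moreover have "(\<Sum>w\<in>A. Abs_fps (\<lambda>k. [:c w $ k:]) * act_series (word_series w) \<phi> {#}) = 0"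
    using act_series_J[OF J, of \<phi> "{#}"] by (simp only: act_series_sum act_series_scalar_series_mult)
  ultimately show "c v $ k = 0 $ k" by simp
qed

lemma topological_basis_increasing_words:
  "topological_basis_family (H_algebra N) (increasing_words N) (monomial N \<nu>)"
  unfolding H_algebra_eq
proof (rule topological_basis_familyI)
  show "word_series w \<in> free_carrier (H_gens N)" "monomial N \<nu> w = cls (word_series w)"
    if "w \<in> increasing_words N" for w
    using that by (simp_all add: increasing_words_def word_series_in_carrier monomial_eq)
next
  show "c v = 0" if "finite A" "A \<subseteq> increasing_words N"
    "(\<Sum>w\<in>A. scalar_series (c w) * word_series w) \<in> J" "v \<in> A" for A c v
    using that by (intro increasing_words_independent)
qed (rule dense_increasing_words)

end

theorem corollary3p4:
  fixes N :: nat and \<nu> :: "nat \<Rightarrow> nat \<Rightarrow> complex"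
  assumes "2 \<le> N"
    and "orthonormal_basis_coeffs N \<nu>"
  shows "topological_basis_family (H_algebra N) (increasing_words N) (monomial N \<nu>)"
proof -
  interpret hat_basis N \<nu> by standard (fact assms)+
  show ?thesis by (rule topological_basis_increasing_words)
qed

end
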